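(* Let $\mathcal{D}$ be a central division algebra with center $K$ and let $f(x)\in K[x]$ be irreducible over $K$. Let $L$ be the field $K[x]/(f(x))$. Then $f(x)$ remains irreducible in $\mathcal{D}[x]$ if and only if the algebra $\mathcal{D}\otimes_K L$ has no zero divisors.
   Context: $K$ is a field. A central division algebra with center $K$ is a finite-dimensional associative unital $K$-algebra with center exactly $K$ in which every nonzero element is invertible. $\mathcal{D}[x]$ is the ring of polynomials in $x$ with coefficients in $\mathcal{D}$, where $x$ commutes with all elements of $\mathcal{D}$; it contains $K[x]$. A non-constant polynomial in $\mathcal{D}[x]$ is irreducible in $\mathcal{D}[x]$ if it is not a product of two non-constant polynomials of $\mathcal{D}[x]$. "No zero divisors" means there are no nonzero elements $u,v$ with $uv=0$. *)

theory Defs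
  imports "HOL-Algebra.Algebra"
begin

definition ring_center :: "('a, 'm) ring_scheme \<Rightarrow> 'a set"
  where "ring_center R =
    {z \<in> carrier R. \<forall>x \<in> carrier R. z \<otimes>\<^bsub>R\<^esub> x = x \<otimes>\<^bsub>R\<^esub> z}"

locale division_ring = ring D for D (structure) +
  assumes one_not_zero: "\<one> \<noteq> \<zero>"
    and units: "Units D = carrier D - {\<zero>}"

locale central_division_algebra = division_ring D + subfield K D
  for K and D (structure) +
  assumes center_eq: "ring_center D = K"
    and finite_dim: "finite_dimension K (carrier D)"

definition zero_divisor_free :: "('a, 'm) ring_scheme \<Rightarrow> bool"
  where "zero_divisor_free R \<longleftrightarrow>
    \<not> (\<exists>u \<in> carrier R - {\<zero>\<^bsub>R\<^esub>}. \<exists>v \<in> carrier R - {\<zero>\<^bsub>R\<^esub>}.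
        u \<otimes>\<^bsub>R\<^esub> v = \<zero>\<^bsub>R\<^esub>)"

text \<open>
  The ring \<open>(carrier R)[X]\<^bsub>R\<^esub>\<close> of \<^theory>\<open>HOL-Algebra.Polynomials\<close> makes sense for a
  noncommutative \<open>R\<close> and has a central variable. The predicate \<^const>\<open>ring_irreducible\<close>, on the
  other hand, is phrased by left divisibility, so irreducibility is spelled out here.
\<close>

definition irreducible_poly_over :: "('a, 'm) ring_scheme \<Rightarrow> 'a list \<Rightarrow> bool"
  where "irreducible_poly_over R p \<longleftrightarrow>
    p \<in> carrier ((carrier R)[X]\<^bsub>R\<^esub>) \<and> 0 < degree p \<and>
    \<not> (\<exists>g \<in> carrier ((carrier R)[X]\<^bsub>R\<^esub>). \<exists>h \<in> carrier ((carrier R)[X]\<^bsub>R\<^esub>).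
        0 < degree g \<and> 0 < degree h \<and> p = g \<otimes>\<^bsub>(carrier R)[X]\<^bsub>R\<^esub>\<^esub> h)"

text \<open>
  The tensor product of two \<open>K\<close>-algebras \<open>A\<close> and \<open>B\<close>, whose scalar actions are given by the
  structure maps \<open>\<phi>\<close> and \<open>\<psi>\<close> from \<open>K\<close> into their centers: the free abelian group on
  \<open>A \<times> B\<close> modulo the subgroup generated by the bilinearity relations, with the product induced by
  \<open>(a \<otimes> b)(a' \<otimes> b') = aa' \<otimes> bb'\<close>.
\<close>

definition pair_mult ::
  "('a, 'm) ring_scheme \<Rightarrow> ('b, 'n) ring_scheme \<Rightarrow>
    ('a \<times> 'b \<Rightarrow>\<^sub>0 int) \<Rightarrow> ('a \<times> 'b \<Rightarrow>\<^sub>0 int) \<Rightarrow> ('a \<times> 'b \<Rightarrow>\<^sub>0 int)"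
  where "pair_mult A B p q =
    frag_extend (\<lambda>(a, b). frag_extend (\<lambda>(a', b').
      frag_of (a \<otimes>\<^bsub>A\<^esub> a', b \<otimes>\<^bsub>B\<^esub> b')) q) p"

definition pair_ring ::
  "('a, 'm) ring_scheme \<Rightarrow> ('b, 'n) ring_scheme \<Rightarrow> ('a \<times> 'b \<Rightarrow>\<^sub>0 int) ring"
  where "pair_ring A B =
    \<lparr>carrier = {p. Poly_Mapping.keys p \<subseteq> carrier A \<times> carrier B},
     monoid.mult = pair_mult A B,
     one = frag_of (\<one>\<^bsub>A\<^esub>, \<one>\<^bsub>B\<^esub>),
     ring.zero = 0,
     ring.add = (+)\<rparr>"

definition tensor_relations ::
  "'k set \<Rightarrow> ('a, 'm) ring_scheme \<Rightarrow> ('k \<Rightarrow> 'a) \<Rightarrow> ('b, 'n) ring_scheme \<Rightarrow> ('k \<Rightarrow> 'b)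
    \<Rightarrow> ('a \<times> 'b \<Rightarrow>\<^sub>0 int) set"
  where "tensor_relations K A \<phi> B \<psi> =
    {frag_of (a \<oplus>\<^bsub>A\<^esub> a', b) - frag_of (a, b) - frag_of (a', b) | a a' b.
      a \<in> carrier A \<and> a' \<in> carrier A \<and> b \<in> carrier B} \<union>
    {frag_of (a, b \<oplus>\<^bsub>B\<^esub> b') - frag_of (a, b) - frag_of (a, b') | a b b'.
      a \<in> carrier A \<and> b \<in> carrier B \<and> b' \<in> carrier B} \<union>
    {frag_of (\<phi> k \<otimes>\<^bsub>A\<^esub> a, b) - frag_of (a, \<psi> k \<otimes>\<^bsub>B\<^esub> b) | k a b.
      k \<in> K \<and> a \<in> carrier A \<and> b \<in> carrier B}"

definition tensor_subgroup ::
  "'k set \<Rightarrow> ('a, 'm) ring_scheme \<Rightarrow> ('k \<Rightarrow> 'a) \<Rightarrow> ('b, 'n) ring_scheme \<Rightarrow> ('k \<Rightarrow> 'b)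
    \<Rightarrow> ('a \<times> 'b \<Rightarrow>\<^sub>0 int) set"
  where "tensor_subgroup K A \<phi> B \<psi> =
    generate (add_monoid (pair_ring A B)) (tensor_relations K A \<phi> B \<psi>)"

definition tensor_algebra ::
  "'k set \<Rightarrow> ('a, 'm) ring_scheme \<Rightarrow> ('k \<Rightarrow> 'a) \<Rightarrow> ('b, 'n) ring_scheme \<Rightarrow> ('k \<Rightarrow> 'b)
    \<Rightarrow> ('a \<times> 'b \<Rightarrow>\<^sub>0 int) set ring"
  where "tensor_algebra K A \<phi> B \<psi> = pair_ring A B Quot tensor_subgroup K A \<phi> B \<psi>"

text \<open>The structure map of \<open>K[x]/(p)\<close>, sending \<open>k\<close> to the class of the constant polynomial \<open>k\<close>.\<close>

definition rupture_const :: "('a, 'm) ring_scheme \<Rightarrow> 'a set \<Rightarrow> 'a list \<Rightarrow> 'a \<Rightarrow> 'a list set"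
  where "rupture_const R K p k = ring.rupture_surj R K p (ring.poly_of_const R k)"

end

theory Submission
  imports Defs
begin

text \<open>
  Write \<open>P = D[X]\<close>. Since \<open>f\<close> is central in \<open>P\<close>, the map
  \<open>a \<otimes> [q] \<mapsto> [a q]\<close> is a ring homomorphism from \<open>D \<otimes>\<^sub>K L\<close> onto \<open>P / P f\<close>. It is injective:
  modulo the bilinearity relations every tensor is \<open>\<Sum>i<deg f. a\<^sub>i \<otimes> [X]\<^sup>i\<close>, whose image is the class
  of a polynomial of degree less than \<open>deg f\<close>, so it vanishes only if all \<open>a\<^sub>i\<close> do.
  A proper factorization \<open>f = g h\<close> gives zero divisors in \<open>P / P f\<close>. Conversely, if
  \<open>g h \<in> P f\<close> with \<open>g, h \<notin> P f\<close> and \<open>g\<close> has minimal degree among such left zero divisors, write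
  \<open>f = q g + r\<close> with \<open>deg r < deg g\<close>. Then \<open>r h \<in> P f\<close>, so \<open>r = 0\<close> by minimality and
  \<open>f = q g\<close> is a proper factorization.
\<close>

section \<open>The ring of formal sums of pairs\<close>

lemma frag_extend_minus_fun:
  "frag_extend (\<lambda>x. f x - g x) c = frag_extend f c - frag_extend g c"
  by (induction c rule: frag_induction[OF subset_UNIV]) (auto simp: frag_extend_diff)

lemma pair_mult_frag_of [simp]:
  "pair_mult A B (frag_of (a, b)) (frag_of (a', b')) = frag_of (a \<otimes>\<^bsub>A\<^esub> a', b \<otimes>\<^bsub>B\<^esub> b')"
  by (simp add: pair_mult_def)

lemma pair_mult_0 [simp]: "pair_mult A B 0 q = 0" "pair_mult A B p 0 = 0"
  by (auto simp: pair_mult_def intro: frag_extend_eq_0)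

lemma pair_mult_diff_left: "pair_mult A B (p - p') q = pair_mult A B p q - pair_mult A B p' q"
  by (simp add: pair_mult_def frag_extend_diff)

text \<open>The second argument sits inside the function that is extended over \<open>p\<close>.
  Additivity there is \<open>frag_extend_minus_fun\<close>, the linearity of
  \<open>frag_extend\<close> in the function being extended.\<close>

lemma pair_mult_diff_right: "pair_mult A B p (q - q') = pair_mult A B p q - pair_mult A B p q'"
  unfolding pair_mult_def frag_extend_diff frag_extend_minus_fun[symmetric]
  by (rule frag_extend_eq) auto

lemma pair_mult_add_left: "pair_mult A B (p + p') q = pair_mult A B p q + pair_mult A B p' q"
  using pair_mult_diff_left[of A B "p + p'" p' q] by simp

lemma pair_mult_add_right: "pair_mult A B p (q + q') = pair_mult A B p q + pair_mult A B p q'"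
  using pair_mult_diff_right[of A B p "q + q'" q'] by simp

lemma carrier_pair_ring: "carrier (pair_ring A B) = {p. Poly_Mapping.keys p \<subseteq> carrier A \<times> carrier B}"
  and mult_pair_ring: "monoid.mult (pair_ring A B) = pair_mult A B"
  and one_pair_ring: "\<one>\<^bsub>pair_ring A B\<^esub> = frag_of (\<one>\<^bsub>A\<^esub>, \<one>\<^bsub>B\<^esub>)"
  and zero_pair_ring: "\<zero>\<^bsub>pair_ring A B\<^esub> = 0"
  and add_pair_ring: "ring.add (pair_ring A B) = (+)"
  by (simp_all add: pair_ring_def)

lemmas pair_ring_simps = carrier_pair_ring mult_pair_ring one_pair_ring zero_pair_ring add_pair_ring

lemma frag_of_in_pair_ring [simp]:
  "frag_of x \<in> carrier (pair_ring A B) \<longleftrightarrow> x \<in> carrier A \<times> carrier B"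
  by (simp add: carrier_pair_ring)

lemma diff_in_pair_ring:
  "\<lbrakk>p \<in> carrier (pair_ring A B); q \<in> carrier (pair_ring A B)\<rbrakk> \<Longrightarrow> p - q \<in> carrier (pair_ring A B)"
  using keys_diff[of p q] by (auto simp: carrier_pair_ring)

text \<open>Makes the universal property of free abelian groups and their subgroup theory available
  for the formal sums.\<close>

lemma add_monoid_pair_ring:
  "add_monoid (pair_ring A B) = free_Abelian_group (carrier A \<times> carrier B)"
  by (simp add: pair_ring_def free_Abelian_group_def)

context
  fixes A :: "('a, 'm) ring_scheme" and B :: "('b, 'n) ring_scheme"
  assumes A: "monoid A" and B: "monoid B"
begin

lemma pair_mult_closed:
  assumes "Poly_Mapping.keys p \<subseteq> carrier A \<times> carrier B" "Poly_Mapping.keys q \<subseteq> carrier A \<times> carrier B"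
  shows "Poly_Mapping.keys (pair_mult A B p q) \<subseteq> carrier A \<times> carrier B"
  using assms(1)
proof (induction p rule: frag_induction)
  case (one x)
  from assms(2) show ?case
  proof (induction q rule: frag_induction)
    case (one y)
    then show ?case using \<open>x \<in> carrier A \<times> carrier B\<close> monoid.m_closed[OF A] monoid.m_closed[OF B]
      by (cases x; cases y) auto
  next
    case (diff p q)
    then show ?case using keys_diff by (fastforce simp: pair_mult_diff_right)
  qed simp
next
  case (diff p q)
  then show ?case using keys_diff by (fastforce simp: pair_mult_diff_left)
qed simp

lemma pair_mult_assoc:
  assumes "Poly_Mapping.keys p \<subseteq> carrier A \<times> carrier B" "Poly_Mapping.keys q \<subseteq> carrier A \<times> carrier B"
    "Poly_Mapping.keys r \<subseteq> carrier A \<times> carrier B"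
  shows "pair_mult A B (pair_mult A B p q) r = pair_mult A B p (pair_mult A B q r)"
  using assms(1)
proof (induction p rule: frag_induction)
  case (one x)
  from assms(2) show ?case
  proof (induction q rule: frag_induction)
    case (one y)
    from assms(3) show ?case
    proof (induction r rule: frag_induction)
      case (one z)
      then show ?case
        using \<open>x \<in> carrier A \<times> carrier B\<close> \<open>y \<in> carrier A \<times> carrier B\<close>
          monoid.m_assoc[OF A] monoid.m_assoc[OF B]
        by (cases x; cases y; cases z) auto
    next
      case (diff p q)
      then show ?case by (simp add: pair_mult_diff_right)
    qed simp
  next
    case (diff p q)
    then show ?case by (simp add: pair_mult_diff_right pair_mult_diff_left)
  qed simp
next
  case (diff p q)
  then show ?case by (simp add: pair_mult_diff_left)
qed simp

lemma pair_mult_one_left: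
  assumes "Poly_Mapping.keys p \<subseteq> carrier A \<times> carrier B"
  shows "pair_mult A B (frag_of (\<one>\<^bsub>A\<^esub>, \<one>\<^bsub>B\<^esub>)) p = p"
  using assms by (induction p rule: frag_induction)
    (auto simp: pair_mult_diff_right monoid.l_one[OF A] monoid.l_one[OF B])

lemma pair_mult_one_right:
  assumes "Poly_Mapping.keys p \<subseteq> carrier A \<times> carrier B"
  shows "pair_mult A B p (frag_of (\<one>\<^bsub>A\<^esub>, \<one>\<^bsub>B\<^esub>)) = p"
  using assms by (induction p rule: frag_induction)
    (auto simp: pair_mult_diff_left monoid.r_one[OF A] monoid.r_one[OF B])

text \<open>This is the integral monoid ring of the product of the multiplicative monoids of
  \<open>A\<close> and \<open>B\<close>. The laws hold for generators and extend by additivity; the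
  additions of \<open>A\<close> and \<open>B\<close> enter only with the tensor relations.\<close>

lemma ring_pair_ring: "ring (pair_ring A B)"
proof (rule ringI)
  show "abelian_group (pair_ring A B)"
    by (rule comm_group_abelian_groupI) (unfold add_monoid_pair_ring, rule abelian_free_Abelian_group)
  show "monoid (pair_ring A B)"
    using monoid.one_closed[OF A] monoid.one_closed[OF B]
    by (intro monoidI) (simp_all add: pair_ring_simps pair_mult_assoc pair_mult_one_left
      pair_mult_one_right pair_mult_closed)
qed (simp_all add: pair_ring_simps pair_mult_add_left pair_mult_add_right)

end

section \<open>Homomorphisms out of the ring of formal sums\<close>

lemma pair_ring_hom_diff:
  assumes "abelian_group_hom (pair_ring A B) S \<theta>"
    and "p \<in> carrier (pair_ring A B)" "q \<in> carrier (pair_ring A B)"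
  shows "\<theta> (p - q) = \<theta> p \<ominus>\<^bsub>S\<^esub> \<theta> q"
proof -
  interpret abelian_group_hom "pair_ring A B" S \<theta> by fact
  show ?thesis
    using hom_add[OF diff_in_pair_ring[OF assms(2,3)] assms(3)] assms(2,3) diff_in_pair_ring[OF assms(2,3)]
    by (simp add: add_pair_ring H.minus_eq H.a_assoc H.r_neg)
qed

text \<open>Freeness gives the additive map. It is multiplicative on generators because the
  commuting images allow \<open>h a\<close>, \<open>h c\<close>, \<open>k b\<close>,
  \<open>k d\<close> to be regrouped as \<open>h a\<close>, \<open>k b\<close>, \<open>h c\<close>,
  \<open>k d\<close>.\<close>

lemma pair_ring_hom_exists:
  assumes "ring A" "ring B" "ring S" and h: "h \<in> ring_hom A S" and k: "k \<in> ring_hom B S"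
    and comm: "\<And>a b. \<lbrakk>a \<in> carrier A; b \<in> carrier B\<rbrakk> \<Longrightarrow> h a \<otimes>\<^bsub>S\<^esub> k b = k b \<otimes>\<^bsub>S\<^esub> h a"
  obtains \<theta> where "\<theta> \<in> ring_hom (pair_ring A B) S"
    "\<forall>a \<in> carrier A. \<forall>b \<in> carrier B. \<theta> (frag_of (a, b)) = h a \<otimes>\<^bsub>S\<^esub> k b"
proof -
  interpret A: ring A by fact
  interpret B: ring B by fact
  interpret S: ring S by fact
  interpret F: ring "pair_ring A B" by (rule ring_pair_ring) unfold_locales
  note hc = ring_hom_closed[OF h] and kc = ring_hom_closed[OF k]
  have "(\<lambda>(a, b). h a \<otimes>\<^bsub>S\<^esub> k b) ` (carrier A \<times> carrier B) \<subseteq> carrier (add_monoid S)"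
    using hc kc by auto
  then obtain \<theta> where hom: "\<theta> \<in> hom (free_Abelian_group (carrier A \<times> carrier B)) (add_monoid S)"
    and gen: "\<And>x. x \<in> carrier A \<times> carrier B \<Longrightarrow> \<theta> (frag_of x) = (\<lambda>(a, b). h a \<otimes>\<^bsub>S\<^esub> k b) x"
    by (rule comm_group.free_Abelian_group_universal[OF S.a_comm_group]) auto
  interpret \<theta>: abelian_group_hom "pair_ring A B" S \<theta>
    by (rule abelian_group_homI[OF F.is_abelian_group S.is_abelian_group])
      (unfold add_monoid_pair_ring group_hom_def group_hom_axioms_def, use hom S.a_group in simp)
  note sub = pair_ring_hom_diff[OF \<theta>.abelian_group_hom_axioms]
  have mult: "\<theta> (pair_mult A B p q) = \<theta> p \<otimes>\<^bsub>S\<^esub> \<theta> q"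
    if p: "Poly_Mapping.keys p \<subseteq> carrier A \<times> carrier B"
      and q: "Poly_Mapping.keys q \<subseteq> carrier A \<times> carrier B" for p q
  proof -
    note closed = pair_mult_closed[OF A.monoid_axioms B.monoid_axioms]
    have cl: "\<theta> u \<in> carrier S" if "Poly_Mapping.keys u \<subseteq> carrier A \<times> carrier B" for u
      using that \<theta>.hom_closed by (simp add: carrier_pair_ring)
    \<comment> \<open>The difference case of \<open>frag_induction\<close> supplies only the
      induction hypotheses, so the support condition is carried along in the claim.\<close>
    have "Poly_Mapping.keys p \<subseteq> carrier A \<times> carrier B \<and> \<theta> (pair_mult A B p q) = \<theta> p \<otimes>\<^bsub>S\<^esub> \<theta> q"
      using p
    proof (induction p rule: frag_induction)
      case zero
      then show ?case using \<theta>.hom_zero cl[OF q] by (simp add: zero_pair_ring)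
    next
      case (diff u v)
      then have "Poly_Mapping.keys (u - v) \<subseteq> carrier A \<times> carrier B"
        using keys_diff[of u v] by blast
      with diff q show ?case
        by (simp add: pair_mult_diff_left sub carrier_pair_ring closed cl S.minus_eq S.l_distr S.l_minus)
    next
      case (one x)
      then obtain a b where x: "x = (a, b)" "a \<in> carrier A" "b \<in> carrier B" by auto
      have "Poly_Mapping.keys q \<subseteq> carrier A \<times> carrier B \<and>
          \<theta> (pair_mult A B (frag_of x) q) = \<theta> (frag_of x) \<otimes>\<^bsub>S\<^esub> \<theta> q"
        using q
      proof (induction q rule: frag_induction)
        case zero
        then show ?case using \<theta>.hom_zero cl[of "frag_of x"] one by (simp add: zero_pair_ring)
      next
        case (diff u v)
        then have "Poly_Mapping.keys (u - v) \<subseteq> carrier A \<times> carrier B"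
          using keys_diff[of u v] by blast
        with diff one show ?case
          by (simp add: pair_mult_diff_right sub carrier_pair_ring closed cl S.minus_eq S.r_distr S.r_minus)
      next
        case (one y)
        then obtain c d where y: "y = (c, d)" "c \<in> carrier A" "d \<in> carrier B" by auto
        have "h (a \<otimes>\<^bsub>A\<^esub> c) \<otimes>\<^bsub>S\<^esub> k (b \<otimes>\<^bsub>B\<^esub> d) = h a \<otimes>\<^bsub>S\<^esub> (h c \<otimes>\<^bsub>S\<^esub> k b) \<otimes>\<^bsub>S\<^esub> k d"
          using x y by (simp add: ring_hom_mult[OF h] ring_hom_mult[OF k] hc kc S.m_assoc)
        also have "\<dots> = h a \<otimes>\<^bsub>S\<^esub> (k b \<otimes>\<^bsub>S\<^esub> h c) \<otimes>\<^bsub>S\<^esub> k d"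
          using x y comm by simp
        also have "\<dots> = (h a \<otimes>\<^bsub>S\<^esub> k b) \<otimes>\<^bsub>S\<^esub> (h c \<otimes>\<^bsub>S\<^esub> k d)"
          using x y by (simp add: hc kc S.m_assoc)
        finally show ?case using x y by (simp add: gen)
      qed
      then show ?case using one by simp
    qed
    then show ?thesis ..
  qed
  show thesis
  proof (rule that)
    show "\<theta> \<in> ring_hom (pair_ring A B) S"
      using \<theta>.hom_closed \<theta>.hom_add gen
      by (intro ring_hom_memI)
        (auto simp: mult_pair_ring carrier_pair_ring mult one_pair_ring
          ring_hom_one[OF h] ring_hom_one[OF k])
  qed (use gen in auto)
qed

section \<open>Factoring through quotients and transport along isomorphisms\<close>

lemma induced_hom_exists:
  assumes I: "ideal I R" and "ring S" and h: "h \<in> ring_hom R S"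
    and zero: "\<And>x. x \<in> I \<Longrightarrow> h x = \<zero>\<^bsub>S\<^esub>"
  obtains g where "g \<in> ring_hom (R Quot I) S" "\<forall>r \<in> carrier R. g (I +>\<^bsub>R\<^esub> r) = h r"
proof -
  interpret I: ideal I R by fact
  interpret S: ring S by fact
  \<comment> \<open>Since \<open>h\<close> vanishes on \<open>I\<close>, it is constant on each
    coset, whose image is therefore a singleton.\<close>
  define g where "g c = the_elem (h ` c)" for c
  have g: "g (I +>\<^bsub>R\<^esub> r) = h r" if r: "r \<in> carrier R" for r
  proof -
    have "h s = h r" if "s \<in> I +>\<^bsub>R\<^esub> r" for s
      using that r I.a_subset by (auto simp: a_r_coset_def' zero ring_hom_add[OF h] ring_hom_closed[OF h])
    moreover have "r \<in> I +>\<^bsub>R\<^esub> r" using r by (rule I.a_rcos_self)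
    ultimately have "h ` (I +>\<^bsub>R\<^esub> r) = {h r}" by blast
    then show ?thesis by (simp add: g_def)
  qed
  have "g \<in> ring_hom (R Quot I) S"
  proof (rule ring_hom_memI)
    fix x assume "x \<in> carrier (R Quot I)"
    then obtain r where r: "r \<in> carrier R" "x = I +>\<^bsub>R\<^esub> r" by (auto simp: FactRing_simps)
    then show "g x \<in> carrier S" by (simp add: g ring_hom_closed[OF h])
    fix y assume "y \<in> carrier (R Quot I)"
    then obtain s where s: "s \<in> carrier R" "y = I +>\<^bsub>R\<^esub> s" by (auto simp: FactRing_simps)
    show "g (x \<otimes>\<^bsub>R Quot I\<^esub> y) = g x \<otimes>\<^bsub>S\<^esub> g y"
      using r s by (simp add: FactRing_def I.rcoset_mult_add g ring_hom_mult[OF h])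
    show "g (x \<oplus>\<^bsub>R Quot I\<^esub> y) = g x \<oplus>\<^bsub>S\<^esub> g y"
      using r s by (simp add: FactRing_def I.a_rcos_sum g ring_hom_add[OF h])
  qed (simp add: FactRing_def g ring_hom_one[OF h])
  then show thesis by (rule that) (intro ballI g)
qed

lemma zero_divisor_free_iso:
  assumes "ring R" "ring S" and h: "h \<in> ring_iso R S"
  shows "zero_divisor_free R \<longleftrightarrow> zero_divisor_free S"
proof -
  interpret R: ring R by fact
  interpret S: ring S by fact
  have hom: "h \<in> ring_hom R S" and bij: "bij_betw h (carrier R) (carrier S)"
    using h by (auto simp: ring_iso_def)
  interpret ring_hom_ring R S h by (rule ring_hom_ringI2) fact+
  have inj: "h x = h y \<longleftrightarrow> x = y" if "x \<in> carrier R" "y \<in> carrier R" for x y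
    using bij that by (auto simp: bij_betw_def inj_on_def)
  have zero: "h x = \<zero>\<^bsub>S\<^esub> \<longleftrightarrow> x = \<zero>\<^bsub>R\<^esub>" if "x \<in> carrier R" for x
    using inj[OF that R.zero_closed] by simp
  have "carrier S - {\<zero>\<^bsub>S\<^esub>} = h ` (carrier R - {\<zero>\<^bsub>R\<^esub>})"
    using bij zero by (auto simp: bij_betw_def)
  then have "(\<exists>u \<in> carrier S - {\<zero>\<^bsub>S\<^esub>}. \<exists>v \<in> carrier S - {\<zero>\<^bsub>S\<^esub>}. u \<otimes>\<^bsub>S\<^esub> v = \<zero>\<^bsub>S\<^esub>)
    \<longleftrightarrow> (\<exists>u \<in> carrier R - {\<zero>\<^bsub>R\<^esub>}. \<exists>v \<in> carrier R - {\<zero>\<^bsub>R\<^esub>}. h u \<otimes>\<^bsub>S\<^esub> h v = \<zero>\<^bsub>S\<^esub>)"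
    by simp
  also have "\<dots> \<longleftrightarrow> (\<exists>u \<in> carrier R - {\<zero>\<^bsub>R\<^esub>}. \<exists>v \<in> carrier R - {\<zero>\<^bsub>R\<^esub>}. u \<otimes>\<^bsub>R\<^esub> v = \<zero>\<^bsub>R\<^esub>)"
    by (intro bex_cong refl) (auto simp: zero simp flip: hom_mult)
  finally show ?thesis by (simp add: zero_divisor_free_def)
qed

section \<open>The tensor relations\<close>

context
  fixes K :: "'k set" and A :: "('a, 'm) ring_scheme" and \<phi> :: "'k \<Rightarrow> 'a"
    and B :: "('b, 'n) ring_scheme" and \<psi> :: "'k \<Rightarrow> 'b"
  assumes A: "ring A" and B: "ring B"
    and \<phi>_Pi: "\<phi> \<in> K \<rightarrow> carrier A" and \<psi>_Pi: "\<psi> \<in> K \<rightarrow> carrier B"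
begin

interpretation A: ring A by (fact A)
interpretation B: ring B by (fact B)

lemmas \<phi> = funcset_mem[OF \<phi>_Pi] and \<psi> = funcset_mem[OF \<psi>_Pi]

lemma tensor_relations_closed: "tensor_relations K A \<phi> B \<psi> \<subseteq> carrier (pair_ring A B)"
  unfolding tensor_relations_def
  by (intro Un_least subsetI; clarify; intro diff_in_pair_ring)
    (simp_all add: \<phi> \<psi>)

lemma subgroup_tensor_subgroup: "subgroup (tensor_subgroup K A \<phi> B \<psi>) (free_Abelian_group (carrier A \<times> carrier B))"
  unfolding tensor_subgroup_def add_monoid_pair_ring
  using tensor_relations_closed
  by (intro group.generate_is_subgroup group_free_Abelian_group) (simp add: pair_ring_def free_Abelian_group_def)

lemma tensor_subgroup_zero: "0 \<in> tensor_subgroup K A \<phi> B \<psi>"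
  using subgroup.one_closed[OF subgroup_tensor_subgroup] by simp

lemma tensor_subgroup_add: "p \<in> tensor_subgroup K A \<phi> B \<psi> \<Longrightarrow> q \<in> tensor_subgroup K A \<phi> B \<psi> \<Longrightarrow> p + q \<in> tensor_subgroup K A \<phi> B \<psi>"
  using subgroup.m_closed[OF subgroup_tensor_subgroup] by simp

lemma tensor_subgroup_minus: "p \<in> tensor_subgroup K A \<phi> B \<psi> \<Longrightarrow> - p \<in> tensor_subgroup K A \<phi> B \<psi>"
  using subgroup.m_inv_closed[OF subgroup_tensor_subgroup, of p]
    subgroup.subset[OF subgroup_tensor_subgroup] by (auto simp: subset_iff)

lemma tensor_subgroup_diff: "p \<in> tensor_subgroup K A \<phi> B \<psi> \<Longrightarrow> q \<in> tensor_subgroup K A \<phi> B \<psi> \<Longrightarrow> p - q \<in> tensor_subgroup K A \<phi> B \<psi>"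
  using tensor_subgroup_add[of p "- q"] tensor_subgroup_minus[of q] by simp

lemma tensor_subgroup_sum: "(\<And>i. i \<in> T \<Longrightarrow> u i \<in> tensor_subgroup K A \<phi> B \<psi>) \<Longrightarrow> sum u T \<in> tensor_subgroup K A \<phi> B \<psi>"
  by (induction T rule: infinite_finite_induct) (auto intro: tensor_subgroup_zero tensor_subgroup_add)

lemma tensor_subgroup_add_left:
  "\<lbrakk>a \<in> carrier A; a' \<in> carrier A; b \<in> carrier B\<rbrakk> \<Longrightarrow>
    frag_of (a \<oplus>\<^bsub>A\<^esub> a', b) - frag_of (a, b) - frag_of (a', b) \<in> tensor_subgroup K A \<phi> B \<psi>"
  unfolding tensor_subgroup_def tensor_relations_def by (rule generate.incl) blast

lemma tensor_subgroup_add_right: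
  "\<lbrakk>a \<in> carrier A; b \<in> carrier B; b' \<in> carrier B\<rbrakk> \<Longrightarrow>
    frag_of (a, b \<oplus>\<^bsub>B\<^esub> b') - frag_of (a, b) - frag_of (a, b') \<in> tensor_subgroup K A \<phi> B \<psi>"
  unfolding tensor_subgroup_def tensor_relations_def by (rule generate.incl) blast

lemma tensor_subgroup_scalar:
  "\<lbrakk>k \<in> K; a \<in> carrier A; b \<in> carrier B\<rbrakk> \<Longrightarrow>
    frag_of (\<phi> k \<otimes>\<^bsub>A\<^esub> a, b) - frag_of (a, \<psi> k \<otimes>\<^bsub>B\<^esub> b) \<in> tensor_subgroup K A \<phi> B \<psi>"
  unfolding tensor_subgroup_def tensor_relations_def by (rule generate.incl) blast

text \<open>The additivity relation for zero plus zero is minus this generator.\<close>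

lemma tensor_subgroup_zero_left: "b \<in> carrier B \<Longrightarrow> frag_of (\<zero>\<^bsub>A\<^esub>, b) \<in> tensor_subgroup K A \<phi> B \<psi>"
  using tensor_subgroup_minus[OF tensor_subgroup_add_left[of "\<zero>\<^bsub>A\<^esub>" "\<zero>\<^bsub>A\<^esub>" b]] by simp

lemma tensor_subgroup_zero_right: "a \<in> carrier A \<Longrightarrow> frag_of (a, \<zero>\<^bsub>B\<^esub>) \<in> tensor_subgroup K A \<phi> B \<psi>"
  using tensor_subgroup_minus[OF tensor_subgroup_add_right[of a "\<zero>\<^bsub>B\<^esub>" "\<zero>\<^bsub>B\<^esub>"]] by simp

lemma tensor_subgroup_diff_left:
  assumes "a \<in> carrier A" "a' \<in> carrier A" "b \<in> carrier B"
  shows "frag_of (a, b) - frag_of (a', b) - frag_of (a \<ominus>\<^bsub>A\<^esub> a', b) \<in> tensor_subgroup K A \<phi> B \<psi>"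
proof -
  have "a \<ominus>\<^bsub>A\<^esub> a' \<oplus>\<^bsub>A\<^esub> a' = a"
    using assms by (simp add: A.minus_eq A.a_assoc A.l_neg)
  then show ?thesis
    using tensor_subgroup_add_left[of "a \<ominus>\<^bsub>A\<^esub> a'" a' b] assms
    by (simp add: algebra_simps)
qed

text \<open>Moves scalars from the right factor to the left across a whole sum. With
  \<open>y t\<close> a power of the generator of \<open>L\<close>, this is what brings a tensor into
  normal form.\<close>

lemma tensor_subgroup_finsum_right:
  assumes "finite T" "a \<in> carrier A" "\<And>t. t \<in> T \<Longrightarrow> k t \<in> K" "\<And>t. t \<in> T \<Longrightarrow> y t \<in> carrier B"
  shows "frag_of (a, \<Oplus>\<^bsub>B\<^esub>t \<in> T. \<psi> (k t) \<otimes>\<^bsub>B\<^esub> y t) - (\<Sum>t \<in> T. frag_of (\<phi> (k t) \<otimes>\<^bsub>A\<^esub> a, y t)) \<in> tensor_subgroup K A \<phi> B \<psi>"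
  using assms
proof (induction T)
  case empty
  then show ?case by (simp add: tensor_subgroup_zero_right)
next
  case (insert t T)
  let ?b = "\<psi> (k t) \<otimes>\<^bsub>B\<^esub> y t" and ?c = "\<Oplus>\<^bsub>B\<^esub>t \<in> T. \<psi> (k t) \<otimes>\<^bsub>B\<^esub> y t"
  have "?b \<in> carrier B" "?c \<in> carrier B"
    using insert.prems \<psi> by (auto intro!: B.finsum_closed)
  then have "frag_of (a, ?b \<oplus>\<^bsub>B\<^esub> ?c) - frag_of (a, ?b) - frag_of (a, ?c) \<in> tensor_subgroup K A \<phi> B \<psi>"
    using insert.prems by (intro tensor_subgroup_add_right) auto
  moreover have "frag_of (a, ?c) - (\<Sum>t \<in> T. frag_of (\<phi> (k t) \<otimes>\<^bsub>A\<^esub> a, y t)) \<in> tensor_subgroup K A \<phi> B \<psi>"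
    using insert by auto
  moreover have "frag_of (\<phi> (k t) \<otimes>\<^bsub>A\<^esub> a, y t) - frag_of (a, ?b) \<in> tensor_subgroup K A \<phi> B \<psi>"
    using insert.prems by (intro tensor_subgroup_scalar) auto
  \<comment> \<open>The terms with \<open>?b\<close> and \<open>?c\<close> cancel in this
    combination and leave the claim for \<open>insert t T\<close>.\<close>
  ultimately have "(frag_of (a, ?b \<oplus>\<^bsub>B\<^esub> ?c) - frag_of (a, ?b) - frag_of (a, ?c))
    + (frag_of (a, ?c) - (\<Sum>t \<in> T. frag_of (\<phi> (k t) \<otimes>\<^bsub>A\<^esub> a, y t)))
    - (frag_of (\<phi> (k t) \<otimes>\<^bsub>A\<^esub> a, y t) - frag_of (a, ?b)) \<in> tensor_subgroup K A \<phi> B \<psi>"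
    by (intro tensor_subgroup_diff[OF tensor_subgroup_add])
  moreover have "(\<Oplus>\<^bsub>B\<^esub>t \<in> insert t T. \<psi> (k t) \<otimes>\<^bsub>B\<^esub> y t) = ?b \<oplus>\<^bsub>B\<^esub> ?c"
    using insert \<psi> by (intro B.finsum_insert) auto
  ultimately show ?case using insert.hyps by (simp add: algebra_simps)
qed

text \<open>The kernel is a subgroup, so only the generating relations have to be checked. The
  additive ones follow from distributivity; the scalar one combines the agreement of
  \<open>h\<close> and \<open>g\<close> on scalars with the commutation of their images.\<close>

lemma tensor_subgroup_subset_kernel:
  assumes S: "ring S" and \<theta>: "\<theta> \<in> ring_hom (pair_ring A B) S"
    and h: "h \<in> ring_hom A S" and g: "g \<in> ring_hom B S"
    and \<theta>_gen: "\<And>a b. \<lbrakk>a \<in> carrier A; b \<in> carrier B\<rbrakk> \<Longrightarrow> \<theta> (frag_of (a, b)) = h a \<otimes>\<^bsub>S\<^esub> g b"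
    and comm: "\<And>a b. \<lbrakk>a \<in> carrier A; b \<in> carrier B\<rbrakk> \<Longrightarrow> h a \<otimes>\<^bsub>S\<^esub> g b = g b \<otimes>\<^bsub>S\<^esub> h a"
    and scalars: "\<And>k. k \<in> K \<Longrightarrow> h (\<phi> k) = g (\<psi> k)"
  shows "tensor_subgroup K A \<phi> B \<psi> \<subseteq> a_kernel (pair_ring A B) S \<theta>"
proof -
  interpret S: ring S by fact
  interpret F: ring "pair_ring A B" by (rule ring_pair_ring) unfold_locales
  interpret \<theta>: ring_hom_ring "pair_ring A B" S \<theta>
    by (rule ring_hom_ringI2[OF F.ring_axioms S \<theta>])
  note hc = ring_hom_closed[OF h] and gc = ring_hom_closed[OF g]
  note diff = pair_ring_hom_diff[OF \<theta>.abelian_group_hom_axioms]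
  have cancel: "x \<oplus>\<^bsub>S\<^esub> y \<ominus>\<^bsub>S\<^esub> x \<ominus>\<^bsub>S\<^esub> y = \<zero>\<^bsub>S\<^esub>" if "x \<in> carrier S" "y \<in> carrier S" for x y
    using that by algebra
  have "tensor_relations K A \<phi> B \<psi> \<subseteq> a_kernel (pair_ring A B) S \<theta>"
  proof
    fix p assume p: "p \<in> tensor_relations K A \<phi> B \<psi>"
    have "\<theta> p = \<zero>\<^bsub>S\<^esub>"
      using p unfolding tensor_relations_def
    proof (elim UnE CollectE exE conjE)
      fix a a' b
      assume "p = frag_of (a \<oplus>\<^bsub>A\<^esub> a', b) - frag_of (a, b) - frag_of (a', b)"
        "a \<in> carrier A" "a' \<in> carrier A" "b \<in> carrier B"
      then show ?thesis
        by (simp add: diff diff_in_pair_ring \<theta>_gen ring_hom_add[OF h] S.l_distr hc gc cancel)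
    next
      fix a b b'
      assume "p = frag_of (a, b \<oplus>\<^bsub>B\<^esub> b') - frag_of (a, b) - frag_of (a, b')"
        "a \<in> carrier A" "b \<in> carrier B" "b' \<in> carrier B"
      then show ?thesis
        by (simp add: diff diff_in_pair_ring \<theta>_gen ring_hom_add[OF g] S.r_distr hc gc cancel)
    next
      fix k a b
      assume p: "p = frag_of (\<phi> k \<otimes>\<^bsub>A\<^esub> a, b) - frag_of (a, \<psi> k \<otimes>\<^bsub>B\<^esub> b)"
        and car: "k \<in> K" "a \<in> carrier A" "b \<in> carrier B"
      have "h (\<phi> k \<otimes>\<^bsub>A\<^esub> a) \<otimes>\<^bsub>S\<^esub> g b = g (\<psi> k) \<otimes>\<^bsub>S\<^esub> h a \<otimes>\<^bsub>S\<^esub> g b"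
        using car \<phi> by (simp add: ring_hom_mult[OF h] scalars)
      also have "\<dots> = h a \<otimes>\<^bsub>S\<^esub> g (\<psi> k \<otimes>\<^bsub>B\<^esub> b)"
        using car \<psi> by (simp add: comm[symmetric] ring_hom_mult[OF g] hc gc S.m_assoc)
      finally show ?thesis
        using p car \<phi> \<psi> by (simp add: diff \<theta>_gen hc gc S.minus_eq S.r_neg)
    qed
    moreover have "p \<in> carrier (pair_ring A B)"
      by (rule subsetD[OF tensor_relations_closed p])
    ultimately show "p \<in> a_kernel (pair_ring A B) S \<theta>"
      unfolding a_kernel_def' by blast
  qed
  moreover have "subgroup (a_kernel (pair_ring A B) S \<theta>) (add_monoid (pair_ring A B))"
    by (rule additive_subgroup.a_subgroup[OF ideal.axioms(1)[OF \<theta>.kernel_is_ideal]])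
  ultimately show ?thesis
    unfolding tensor_subgroup_def by (rule F.add.generate_subgroup_incl)
qed

end

section \<open>Quotients by a central element\<close>

text \<open>Passing to representatives lets the degree argument take place in \<open>R\<close>
  itself.\<close>

lemma (in ideal) zero_divisor_free_quotient_iff:
  "zero_divisor_free (R Quot I) \<longleftrightarrow>
    \<not> (\<exists>g \<in> carrier R. \<exists>h \<in> carrier R. g \<notin> I \<and> h \<notin> I \<and> g \<otimes> h \<in> I)"
proof -
  have car: "carrier (R Quot I) = (\<lambda>p. I +> p) ` carrier R"
    by (auto simp: FactRing_simps)
  have z: "I +> p = \<zero>\<^bsub>R Quot I\<^esub> \<longleftrightarrow> p \<in> I" if "p \<in> carrier R" for p
    using that by (metis (no_types, lifting) FactRing_def a_rcos_const a_rcos_self ring.simps(1))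
  have "(I +> g) \<otimes>\<^bsub>R Quot I\<^esub> (I +> h) = \<zero>\<^bsub>R Quot I\<^esub> \<longleftrightarrow> g \<otimes> h \<in> I"
    if "g \<in> carrier R" "h \<in> carrier R" for g h
    using that z[of "g \<otimes> h"] by (simp add: FactRing_def rcoset_mult_add)
  moreover have "carrier (R Quot I) - {\<zero>\<^bsub>R Quot I\<^esub>} = (\<lambda>p. I +> p) ` (carrier R - I)"
    using z unfolding car by blast
  ultimately show ?thesis
    unfolding zero_divisor_free_def by auto
qed

text \<open>Centrality of \<open>f\<close> lets a factor on the right of
  \<open>q \<otimes> f\<close> be moved past \<open>f\<close>, so the left multiples form a
  two-sided ideal.\<close>

lemma (in ring) ideal_central_multiples:
  assumes f: "f \<in> carrier R" and central: "\<And>p. p \<in> carrier R \<Longrightarrow> f \<otimes> p = p \<otimes> f"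
  shows "ideal ((\<lambda>q. q \<otimes> f) ` carrier R) R"
proof (rule idealI)
  let ?I = "(\<lambda>q. q \<otimes> f) ` carrier R"
  show "subgroup ?I (add_monoid R)"
  proof (rule add.subgroupI)
    fix a b assume "a \<in> ?I" "b \<in> ?I"
    then obtain p q where "p \<in> carrier R" "q \<in> carrier R" "a = p \<otimes> f" "b = q \<otimes> f" by blast
    then show "a \<oplus> b \<in> ?I" using f by (intro image_eqI[of _ _ "p \<oplus> q"]) (simp_all add: l_distr)
  next
    fix a assume "a \<in> ?I"
    then obtain p where "p \<in> carrier R" "a = p \<otimes> f" by blast
    then show "\<ominus> a \<in> ?I" using f by (intro image_eqI[of _ _ "\<ominus> p"]) (simp_all add: l_minus)
  qed (use f in auto)
next
  fix a x assume "a \<in> (\<lambda>q. q \<otimes> f) ` carrier R" and x: "x \<in> carrier R"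
  then obtain q where q: "q \<in> carrier R" "a = q \<otimes> f" by blast
  then have "x \<otimes> a = (x \<otimes> q) \<otimes> f" "a \<otimes> x = (q \<otimes> x) \<otimes> f"
    using f x by (simp_all add: m_assoc central)
  then show "x \<otimes> a \<in> (\<lambda>q. q \<otimes> f) ` carrier R" "a \<otimes> x \<in> (\<lambda>q. q \<otimes> f) ` carrier R"
    using q x by blast+
qed (rule ring_axioms)

text \<open>The factorization argument for an abstract degree \<open>\<delta>\<close>, applied later
  to \<open>UP D\<close> with \<open>deg D\<close>. The value \<open>\<delta> \<zero>\<close> is
  left open, hence the separate treatment of zero in the degree and division rules.\<close>

lemma quotient_by_central_zero_divisor_free_iff:
  fixes P (structure) and \<delta> :: "'p \<Rightarrow> nat"
  assumes "ring P" and f: "f \<in> carrier P" "f \<noteq> \<zero>" "0 < \<delta> f"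
    and central: "\<And>p. p \<in> carrier P \<Longrightarrow> f \<otimes> p = p \<otimes> f"
    and mult_nz: "\<And>p q. \<lbrakk>p \<in> carrier P; q \<in> carrier P; p \<noteq> \<zero>; q \<noteq> \<zero>\<rbrakk> \<Longrightarrow> p \<otimes> q \<noteq> \<zero>"
    and deg_mult: "\<And>p q. \<lbrakk>p \<in> carrier P; q \<in> carrier P; p \<noteq> \<zero>; q \<noteq> \<zero>\<rbrakk> \<Longrightarrow> \<delta> (p \<otimes> q) = \<delta> p + \<delta> q"
    and division: "\<And>p g. \<lbrakk>p \<in> carrier P; g \<in> carrier P; g \<noteq> \<zero>\<rbrakk> \<Longrightarrow>
      \<exists>q \<in> carrier P. \<exists>r \<in> carrier P. p = q \<otimes> g \<oplus> r \<and> (r = \<zero> \<or> \<delta> r < \<delta> g)"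
  shows "zero_divisor_free (P Quot ((\<lambda>q. q \<otimes> f) ` carrier P)) \<longleftrightarrow>
    \<not> (\<exists>g \<in> carrier P. \<exists>h \<in> carrier P. 0 < \<delta> g \<and> 0 < \<delta> h \<and> f = g \<otimes> h)"
proof -
  interpret ring P by fact
  define I where "I = (\<lambda>q. q \<otimes> f) ` carrier P"
  have I_memI: "q \<otimes> f \<in> I" if "q \<in> carrier P" for q
    using that by (simp add: I_def)
  have I_memE: thesis if "p \<in> I" "\<And>q. \<lbrakk>q \<in> carrier P; p = q \<otimes> f\<rbrakk> \<Longrightarrow> thesis" for p thesis
    using that by (auto simp: I_def)
  interpret I: ideal I P
    unfolding I_def using f(1) central by (rule ideal_central_multiples)
  have small: "p = \<zero>" if "p \<in> I" "\<delta> p < \<delta> f" for p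
  proof (rule I_memE[OF that(1)])
    fix q assume q: "q \<in> carrier P" "p = q \<otimes> f"
    show ?thesis
    proof (cases "q = \<zero>")
      case False
      then have "\<delta> f \<le> \<delta> p" using deg_mult[of q f] q f by simp
      then show ?thesis using that(2) by simp
    qed (use q f in simp)
  qed
  have "\<exists>g \<in> carrier P. \<exists>h \<in> carrier P. 0 < \<delta> g \<and> 0 < \<delta> h \<and> f = g \<otimes> h"
    if "\<exists>g \<in> carrier P. \<exists>h \<in> carrier P. g \<notin> I \<and> h \<notin> I \<and> g \<otimes> h \<in> I"
  proof -
    \<comment> \<open>Only the left factor is minimised; the partner \<open>h\<close> may change
      from one candidate to another.\<close>
    define Q where "Q g \<longleftrightarrow> g \<in> carrier P \<and> g \<notin> I \<and> (\<exists>h \<in> carrier P. h \<notin> I \<and> g \<otimes> h \<in> I)" for g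
    have "\<exists>g. Q g" using that unfolding Q_def by metis
    then obtain g where "Q g" and min': "\<And>g'. Q g' \<Longrightarrow> \<delta> g \<le> \<delta> g'"
      by (metis ex_has_least_nat)
    then have g: "g \<in> carrier P" "g \<notin> I" "\<exists>h \<in> carrier P. h \<notin> I \<and> g \<otimes> h \<in> I"
      by (auto simp: Q_def)
    have min: "\<delta> g \<le> \<delta> r" if "r \<in> carrier P" "r \<notin> I" "h \<in> carrier P" "h \<notin> I" "r \<otimes> h \<in> I" for r h
      using that by (intro min') (auto simp: Q_def)
    from g(3) obtain h where h: "h \<in> carrier P" "h \<notin> I" "g \<otimes> h \<in> I" by blast
    have g0: "g \<in> carrier P" "g \<noteq> \<zero>" using g(1,2) I.zero_closed by metis+
    \<comment> \<open>The remainder of \<open>g\<close> on division by \<open>f\<close> is congruent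
      to \<open>g\<close> modulo \<open>I\<close>, so it is a left zero divisor modulo
      \<open>I\<close> with the same \<open>h\<close>. By minimality \<open>\<delta> g\<close> is at
      most its degree, which is below \<open>\<delta> f\<close>.\<close>
    have "\<delta> g < \<delta> f"
    proof -
      obtain q r where qr: "q \<in> carrier P" "r \<in> carrier P" "g = q \<otimes> f \<oplus> r"
        "r = \<zero> \<or> \<delta> r < \<delta> f"
        using division[of g f] g0 f by blast
      have "q \<otimes> f \<in> I" using qr I_memI by auto
      then have "r \<notin> I" using qr g I.a_closed by auto
      moreover have r_eq: "r = g \<ominus> q \<otimes> f"
        using qr f by algebra
      have "r \<otimes> h = g \<otimes> h \<oplus> (\<ominus> (q \<otimes> f)) \<otimes> h"
        by (subst r_eq) (use qr(1) g0 f h in \<open>simp add: minus_eq l_distr\<close>)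
      then have "r \<otimes> h \<in> I"
        using h I.a_closed I.I_r_closed I.a_inv_closed \<open>q \<otimes> f \<in> I\<close> by auto
      ultimately have "\<delta> g \<le> \<delta> r" "r \<noteq> \<zero>" using min[of r h] qr h I.zero_closed by auto
      then show ?thesis using qr by auto
    qed
    obtain q r where qr: "q \<in> carrier P" "r \<in> carrier P" "f = q \<otimes> g \<oplus> r" "r = \<zero> \<or> \<delta> r < \<delta> g"
      using division[of f g] g0 f by blast
    have r_eq: "r = f \<ominus> q \<otimes> g"
      using qr g0 by algebra
    have "r \<otimes> h = f \<otimes> h \<ominus> q \<otimes> (g \<otimes> h)"
      by (subst r_eq) (use qr(1) g0 f h in \<open>simp add: minus_eq l_distr l_minus m_assoc\<close>)
    \<comment> \<open>The first product is \<open>h \<otimes> f\<close> by centrality; the second is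
      a left multiple of \<open>g \<otimes> h\<close>.\<close>
    moreover have "f \<otimes> h \<in> I" "q \<otimes> (g \<otimes> h) \<in> I"
      using h(1,3) qr(1) I.I_l_closed I_memI[of h] central[of h] by auto
    ultimately have "r \<otimes> h \<in> I" using I.a_closed I.a_inv_closed by (simp add: minus_eq)
    \<comment> \<open>A nonzero \<open>r\<close> has degree below \<open>\<delta> g\<close>, hence
      below \<open>\<delta> f\<close>, so \<open>small\<close> keeps it out of \<open>I\<close>. It
      would then contradict the minimality of \<open>g\<close>.\<close>
    then have "r = \<zero>"
      using min[of r h] qr h small[of r] \<open>\<delta> g < \<delta> f\<close> by (metis leD order.strict_trans)
    then have f_eq: "f = q \<otimes> g" using qr g0 by simp
    have "q \<noteq> \<zero>" using f_eq f g0 by auto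
    then have "\<delta> f = \<delta> q + \<delta> g" using f_eq deg_mult qr g0 by simp
    \<comment> \<open>If \<open>g\<close> had degree zero, dividing \<open>\<one>\<close> by
      \<open>g\<close> would leave no remainder. The resulting left inverse of \<open>g\<close>
      would put \<open>h\<close> into \<open>I\<close>.\<close>
    moreover have "0 < \<delta> g"
    proof (rule ccontr)
      assume "\<not> 0 < \<delta> g"
      then obtain u where u: "u \<in> carrier P" "\<one> = u \<otimes> g"
        using division[of \<one> g] g0 by auto
      then have "h = u \<otimes> (g \<otimes> h)" using h g0 by (metis l_one m_assoc)
      then show False using h u I.I_l_closed by metis
    qed
    \<comment> \<open>The other factor \<open>q\<close> has positive degree because degrees add and
      \<open>\<delta> g < \<delta> f\<close>.\<close>
    ultimately show ?thesis using f_eq qr g0 \<open>\<delta> g < \<delta> f\<close> by force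
  qed
  moreover have "\<exists>g \<in> carrier P. \<exists>h \<in> carrier P. g \<notin> I \<and> h \<notin> I \<and> g \<otimes> h \<in> I"
    if gh: "g \<in> carrier P" "h \<in> carrier P" "0 < \<delta> g" "0 < \<delta> h" "f = g \<otimes> h" for g h
  proof -
    have "g \<noteq> \<zero>" "h \<noteq> \<zero>" using gh f by auto
    then have "\<delta> f = \<delta> g + \<delta> h" using gh deg_mult by simp
    \<comment> \<open>Each factor has degree below \<open>\<delta> f\<close>, so
      \<open>small\<close> applies to both.\<close>
    then have "g \<notin> I" "h \<notin> I" using small[of g] small[of h] gh \<open>g \<noteq> \<zero>\<close> \<open>h \<noteq> \<zero>\<close> by auto
    moreover have "g \<otimes> h \<in> I" using gh f I_memI[of \<one>] by simp
    ultimately show ?thesis using gh by blast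
  qed
  ultimately show ?thesis unfolding I_def[symmetric] I.zero_divisor_free_quotient_iff by blast
qed

section \<open>Polynomials over a noncommutative ring\<close>

context UP_ring begin

text \<open>Only the index \<open>i = deg R p\<close> contributes to the convolution: below it the
  coefficient of \<open>q\<close> vanishes, above it that of \<open>p\<close>.\<close>

lemma lcoeff_mult:
  assumes "p \<in> carrier P" "q \<in> carrier P"
  shows "up_ring.coeff P (p \<otimes>\<^bsub>P\<^esub> q) (deg R p + deg R q) = lcoeff p \<otimes> lcoeff q"
proof -
  let ?m = "deg R p" and ?n = "deg R q"
  let ?s = "\<lambda>i. up_ring.coeff P p i \<otimes> up_ring.coeff P q (?m + ?n - i)"
  have s: "?s i = (if ?m = i then ?s i else \<zero>)" for i
  proof -
    consider "i < ?m" | "i = ?m" | "?m < i" by linarith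
    then show ?thesis
    proof cases
      case 1
      then have "?n < ?m + ?n - i" by linarith
      with 1 show ?thesis using assms by (simp add: deg_aboveD)
    qed (use assms in \<open>simp_all add: deg_aboveD\<close>)
  qed
  have "up_ring.coeff P (p \<otimes>\<^bsub>P\<^esub> q) (?m + ?n) = (\<Oplus>i \<in> {..?m + ?n}. ?s i)"
    using assms by simp
  also have "\<dots> = (\<Oplus>i \<in> {..?m + ?n}. if ?m = i then ?s i else \<zero>)"
    by (rule R.finsum_cong'[OF refl _ s]) (use assms in auto)
  also have "\<dots> = ?s ?m"
    using assms by (intro R.finsum_singleton) auto
  finally show ?thesis by simp
qed

text \<open>The substitution of \<open>n - i\<close> for \<open>i\<close> turns the convolution for
  one product into that for the other, once the coefficients are swapped.\<close>

lemma commute_if_coeffs_commute: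
  assumes f: "f \<in> carrier P" and p: "p \<in> carrier P"
    and comm: "\<And>n a. a \<in> carrier R \<Longrightarrow> up_ring.coeff P f n \<otimes> a = a \<otimes> up_ring.coeff P f n"
  shows "f \<otimes>\<^bsub>P\<^esub> p = p \<otimes>\<^bsub>P\<^esub> f"
proof (rule up_eqI)
  fix n :: nat
  have bij: "bij_betw (\<lambda>i. n - i) {..n} {..n}"
    by (rule bij_betw_byWitness[where f' = "\<lambda>i. n - i"]) auto
  have "(\<Oplus>i \<in> {..n}. up_ring.coeff P f i \<otimes> up_ring.coeff P p (n - i))
    = (\<Oplus>i \<in> (\<lambda>i. n - i) ` {..n}. up_ring.coeff P f i \<otimes> up_ring.coeff P p (n - i))"
    using bij by (simp add: bij_betw_def)
  also have "\<dots> = (\<Oplus>i \<in> {..n}. up_ring.coeff P f (n - i) \<otimes> up_ring.coeff P p (n - (n - i)))"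
    using bij f p by (intro R.finsum_reindex) (auto simp: bij_betw_def)
  also have "\<dots> = (\<Oplus>i \<in> {..n}. up_ring.coeff P p i \<otimes> up_ring.coeff P f (n - i))"
    using f p by (intro R.finsum_cong') (auto simp: comm)
  finally show "up_ring.coeff P (f \<otimes>\<^bsub>P\<^esub> p) n = up_ring.coeff P (p \<otimes>\<^bsub>P\<^esub> f) n"
    using f p by simp
qed (use f p in auto)

text \<open>Long division by cancelling leading terms. All multipliers of \<open>g\<close> are
  placed on its left, which fixes the side of the quotient.\<close>

lemma right_division:
  assumes g: "g \<in> carrier P" "lcoeff g \<in> Units R" and "p \<in> carrier P"
  shows "\<exists>q \<in> carrier P. \<exists>r \<in> carrier P. p = q \<otimes>\<^bsub>P\<^esub> g \<oplus>\<^bsub>P\<^esub> r \<and> (r = \<zero>\<^bsub>P\<^esub> \<or> deg R r < deg R g)"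
  using assms(3)
\<comment> \<open>Zero and nonzero constants both have degree 0. The measure separates them, so that
  cancelling a constant down to zero still counts as a decrease.\<close>
proof (induction "if p = \<zero>\<^bsub>P\<^esub> then 0 else Suc (deg R p)" arbitrary: p rule: less_induct)
  case less
  show ?case
  proof (cases "p = \<zero>\<^bsub>P\<^esub> \<or> deg R p < deg R g")
    case True
    then show ?thesis using less.prems g by (intro bexI[of _ "\<zero>\<^bsub>P\<^esub>"] bexI[of _ p]) auto
  next
    case False
    define t where "t = up_ring.monom P (lcoeff p \<otimes> inv (lcoeff g)) (deg R p - deg R g)"
    have c: "lcoeff p \<otimes> inv (lcoeff g) \<in> carrier R" using less.prems g by simp
    then have t: "t \<in> carrier P" by (simp add: t_def)
    define p' where "p' = p \<ominus>\<^bsub>P\<^esub> t \<otimes>\<^bsub>P\<^esub> g"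
    have p': "p' \<in> carrier P" using t g less.prems by (simp add: p'_def)
    have "deg R (t \<otimes>\<^bsub>P\<^esub> g) \<le> deg R p"
    proof -
      have "deg R t \<le> deg R p - deg R g" unfolding t_def using c by (rule deg_monom_le)
      then show ?thesis using deg_mult_ring[OF t g(1)] False by linarith
    qed
    then have le: "deg R p' \<le> deg R p"
      using p' t g less.prems by (intro deg_aboveI) (auto simp: p'_def deg_aboveD)
    have "up_ring.coeff P (t \<otimes>\<^bsub>P\<^esub> g) (deg R p) = lcoeff p \<otimes> inv (lcoeff g) \<otimes> lcoeff g"
      using coeff_monom_mult[OF c g(1), of "deg R p - deg R g" "deg R g"] False by (simp add: t_def)
    also have "\<dots> = lcoeff p" using g less.prems by (simp add: R.m_assoc)
    finally have "up_ring.coeff P p' (deg R p) = \<zero>"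
      using t g less.prems by (simp add: p'_def)
    then have "p' = \<zero>\<^bsub>P\<^esub> \<or> deg R p' < deg R p"
      using lcoeff_nonzero[OF _ p'] le by force
    then have "(if p' = \<zero>\<^bsub>P\<^esub> then 0 else Suc (deg R p')) < (if p = \<zero>\<^bsub>P\<^esub> then 0 else Suc (deg R p))"
      using False by auto
    from less.hyps[OF this p'] obtain q r where qr: "q \<in> carrier P" "r \<in> carrier P" "p' = q \<otimes>\<^bsub>P\<^esub> g \<oplus>\<^bsub>P\<^esub> r"
        "r = \<zero>\<^bsub>P\<^esub> \<or> deg R r < deg R g"
      by blast
    have "p = t \<otimes>\<^bsub>P\<^esub> g \<oplus>\<^bsub>P\<^esub> p'"
      unfolding p'_def using t g(1) less.prems by algebra
    also have "\<dots> = (t \<oplus>\<^bsub>P\<^esub> q) \<otimes>\<^bsub>P\<^esub> g \<oplus>\<^bsub>P\<^esub> r"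
      using qr t g by (simp add: P.l_distr P.a_assoc)
    finally show ?thesis using qr t by blast
  qed
qed

lemma monom_one_pow: "up_ring.monom P \<one> 1 [^]\<^bsub>P\<^esub> n = up_ring.monom P \<one> n"
  by (induction n) (simp_all add: monom_one_Suc del: One_nat_def)

text \<open>Bounds the degree of the polynomial attached to a reduced tensor. Positivity of
  \<open>n\<close> is essential, since an empty sum has degree 0.\<close>

lemma deg_finsum_monom_less:
  assumes "\<And>i. g i \<in> carrier R" "0 < n"
  shows "deg R (\<Oplus>\<^bsub>P\<^esub>i \<in> {..<n}. up_ring.monom P (g i) i) < n"
proof -
  have "deg R (\<Oplus>\<^bsub>P\<^esub>i \<in> {..<n}. up_ring.monom P (g i) i) \<le> n - 1"
  proof (rule deg_aboveI)
    fix m assume "n - 1 < m"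
    then have "(\<Oplus>i \<in> {..<n}. up_ring.coeff P (up_ring.monom P (g i) i) m) = (\<Oplus>i \<in> {..<n}. \<zero>)"
      using assms(1) by (intro R.finsum_cong') (auto simp: Pi_iff)
    then show "up_ring.coeff P (\<Oplus>\<^bsub>P\<^esub>i \<in> {..<n}. up_ring.monom P (g i) i) m = \<zero>"
      using assms(1) by (simp add: coeff_finsum Pi_def)
  qed (use assms in \<open>auto intro!: P.finsum_closed\<close>)
  then show ?thesis using assms(2) by linarith
qed

lemma coeff_finsum_monom:
  assumes "\<And>i. g i \<in> carrier R" "m < n"
  shows "up_ring.coeff P (\<Oplus>\<^bsub>P\<^esub>i \<in> {..<n}. up_ring.monom P (g i) i) m = g m"
proof -
  have "up_ring.coeff P (\<Oplus>\<^bsub>P\<^esub>i \<in> {..<n}. up_ring.monom P (g i) i) m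
    = (\<Oplus>i \<in> {..<n}. if m = i then g i else \<zero>)"
    using assms(1) by (auto simp: coeff_finsum Pi_def intro!: R.finsum_cong')
  also have "\<dots> = g m"
    using assms by (intro R.finsum_singleton) auto
  finally show ?thesis .
qed

end

section \<open>Polynomials as coefficient lists and as coefficient functions\<close>

context ring begin

lemma coeff_in_UP:
  assumes "polynomial (carrier R) p" shows "coeff p \<in> carrier (UP R)"
proof -
  have "coeff p \<in> up R"
    using assms coeff_length[of p] polynomial_incl[OF assms]
    by (intro mem_upI) (auto intro!: exI[of _ "length p"])
  then show ?thesis by (simp add: UP_def)
qed

lemma coeff_UP:
  assumes "p \<in> carrier (UP R)" shows "up_ring.coeff (UP R) p = p"
  using assms by (auto simp: UP_def)

text \<open>Both degrees are the least index above which all coefficients vanish.\<close>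

lemma deg_coeff:
  assumes "polynomial (carrier R) p" shows "deg R (coeff p) = degree p"
  using degree_def'[OF assms] coeff_in_UP[OF assms] by (simp add: deg_def bound_def coeff_UP)

lemma coeff_poly_mult_UP:
  assumes "polynomial (carrier R) p" "polynomial (carrier R) q"
  shows "coeff (poly_mult p q) = coeff p \<otimes>\<^bsub>UP R\<^esub> coeff q"
  using assms[THEN coeff_in_UP] assms[THEN polynomial_incl]
  by (simp add: poly_mult_coeff UP_def)

lemma coeff_poly_add_UP:
  assumes "polynomial (carrier R) p" "polynomial (carrier R) q"
  shows "coeff (poly_add p q) = coeff p \<oplus>\<^bsub>UP R\<^esub> coeff q"
  using assms[THEN coeff_in_UP] assms[THEN polynomial_incl]
  by (simp add: poly_add_coeff UP_def del: poly_add.simps)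

text \<open>A normalized list is determined by its coefficients. Conversely, a function of bounded
  support is tabulated as a list, and stripping leading zeros does not change the
  coefficients.\<close>

lemma coeff_bij_UP: "bij_betw coeff (carrier (poly_ring R)) (carrier (UP R))"
  unfolding bij_betw_def
proof
  show "inj_on coeff (carrier (poly_ring R))"
    by (auto intro!: inj_onI simp: coeff_iff_polynomial_cond simp flip: univ_poly_carrier)
  have "u \<in> coeff ` carrier (poly_ring R)" if "u \<in> carrier (UP R)" for u
  proof -
    have u: "u \<in> up R" using that by (simp add: UP_def)
    then obtain n where n: "bound \<zero> n u" by auto
    \<comment> \<open>Lists carry the highest coefficient first, hence the reversal.\<close>
    define l where "l = map u (rev [0..<Suc n])"
    have "coeff l i = u i" for i
    proof (cases "i < length l")
      case True
      then show ?thesis by (subst coeff_nth) (auto simp: l_def rev_nth simp del: upt_Suc)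
    next
      case False
      then show ?thesis using n coeff_length[of l i] by (auto simp: bound_def l_def)
    qed
    then have "coeff l = u" by (rule ext)
    then have "u = coeff (normalize l)" using normalize_coeff[of l] by metis
    moreover have "set l \<subseteq> carrier R" using u by (auto simp: l_def)
    then have "normalize l \<in> carrier (poly_ring R)"
      by (simp add: normalize_gives_polynomial flip: univ_poly_carrier)
    ultimately show ?thesis by blast
  qed
  then show "coeff ` carrier (poly_ring R) = carrier (UP R)"
    using coeff_in_UP by (auto simp: univ_poly_carrier)
qed

text \<open>The bijection \<open>coeff\<close> respects products and degrees, so it carries
  factorizations in both directions.\<close>

lemma irreducible_poly_over_iff_UP:
  assumes "p \<in> carrier (poly_ring R)" "0 < degree p"
  shows "irreducible_poly_over R p \<longleftrightarrow>
    \<not> (\<exists>g \<in> carrier (UP R). \<exists>h \<in> carrier (UP R).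
      0 < deg R g \<and> 0 < deg R h \<and> coeff p = g \<otimes>\<^bsub>UP R\<^esub> h)"
proof -
  note car = univ_poly_carrier[symmetric]
  have eq: "p = g \<otimes>\<^bsub>poly_ring R\<^esub> h \<longleftrightarrow> coeff p = coeff g \<otimes>\<^bsub>UP R\<^esub> coeff h"
    if "g \<in> carrier (poly_ring R)" "h \<in> carrier (poly_ring R)" for g h
    using assms that poly_mult_closed[OF carrier_is_subring]
    by (simp add: car coeff_iff_polynomial_cond[of "carrier R" p "poly_mult g h"] univ_poly_mult
        coeff_poly_mult_UP)
  have UP: "carrier (UP R) = coeff ` carrier (poly_ring R)"
    using coeff_bij_UP by (simp add: bij_betw_def)
  have deg: "deg R (coeff g) = degree g" if "g \<in> carrier (poly_ring R)" for g
    using that by (simp add: car deg_coeff)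
  show ?thesis
    unfolding irreducible_poly_over_def UP using assms by (simp add: deg eq cong: bex_cong conj_cong)
qed

end

section \<open>Comparison of the tensor algebra with the polynomial quotient\<close>

locale central_irreducible_polynomial = central_division_algebra K D for K and D (structure) +
  fixes f
  assumes f_closed: "f \<in> carrier (K[X])" and f_irreducible: "pirreducible K f"
begin

section \<open>The field \<open>L\<close>, the polynomial ring \<open>U\<close> over
  \<open>D\<close>, and the ideal \<open>J\<close> of multiples of \<open>f\<close>\<close>

abbreviation "E \<equiv> D\<lparr>carrier := K\<rparr>"
abbreviation "L \<equiv> Rupt K f"
abbreviation "quot \<equiv> rupture_surj K f"
abbreviation "\<psi> \<equiv> rupture_const D K f"
abbreviation "\<alpha> \<equiv> quot X"
abbreviation "U \<equiv> UP D"
abbreviation "J \<equiv> (\<lambda>q. q \<otimes>\<^bsub>U\<^esub> coeff f) ` carrier U"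
abbreviation "N \<equiv> tensor_subgroup K D (\<lambda>k. k) L \<psi>"

lemma integral: "\<lbrakk>a \<in> carrier D; b \<in> carrier D; a \<noteq> \<zero>; b \<noteq> \<zero>\<rbrakk> \<Longrightarrow> a \<otimes> b \<noteq> \<zero>"
  using units Units_m_closed[of a b] by blast

lemma K_commute: "\<lbrakk>k \<in> K; a \<in> carrier D\<rbrakk> \<Longrightarrow> k \<otimes> a = a \<otimes> k"
  using center_eq by (auto simp: ring_center_def)

lemmas subfield_K = subfield_axioms
lemmas subring_K = subfieldE(1)[OF subfield_K]
lemmas K_sub = subringE(1)[OF subring_K]

sublocale E: field E
  by (rule subfield_iff(2)[OF subfield_K])

text \<open>The polynomial operations read only the ring operations, which \<open>E\<close> shares
  with \<open>D\<close>. Results on polynomials over the field \<open>E\<close> thus apply to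
  \<open>K[X]\<close> as formed inside the noncommutative \<open>D\<close>.\<close>

lemma KX_eq: "univ_poly E = univ_poly D"
  by (rule univ_poly_consistent[OF subring_K])

sublocale KX: domain "K[X]"
  using E.univ_poly_is_domain[OF E.carrier_is_subring] by (simp add: KX_eq)

sublocale U: UP_ring D U
  by unfold_locales

lemma Rupt_eq: "rupture E = rupture D"
  by (intro ext) (simp add: rupture_def KX_eq)

sublocale PIdl: ideal "PIdl\<^bsub>K[X]\<^esub> f" "K[X]"
  by (rule KX.cgenideal_ideal[OF f_closed])

sublocale L: field L
  using E.rupture_is_field_iff_pirreducible[OF E.carrier_is_subfield] f_closed f_irreducible
  by (simp add: KX_eq Rupt_eq)

sublocale quot: ring_hom_ring "K[X]" L quot
  unfolding rupture_def by (rule PIdl.rcos_ring_hom_ring)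

lemma degree_f: "0 < degree f"
  using pirreducible_degree[OF subfield_K f_closed f_irreducible] by simp

lemma f_nonzero: "f \<noteq> []"
  using degree_f by auto

lemma polynomial_D: "q \<in> carrier (K[X]) \<Longrightarrow> polynomial (carrier D) q"
  using carrier_polynomial[OF subring_K] by (simp add: univ_poly_carrier)

lemma coeff_in_K: "q \<in> carrier (K[X]) \<Longrightarrow> coeff q i \<in> K"
  using polynomial_incl[of K q] E.coeff_in_carrier[of q i] coeff_consistent[OF subring_K]
  by (simp add: univ_poly_carrier)

lemma coeff_in_U: "q \<in> carrier (K[X]) \<Longrightarrow> coeff q \<in> carrier U"
  by (rule coeff_in_UP[OF polynomial_D])

lemma coeff_hom: "coeff \<in> ring_hom (K[X]) U"
proof (rule ring_hom_memI)
  show "coeff \<one>\<^bsub>K[X]\<^esub> = \<one>\<^bsub>U\<^esub>"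
    by (auto simp: univ_poly_one UP_def)
qed (simp_all add: coeff_in_U univ_poly_mult univ_poly_add coeff_poly_mult_UP coeff_poly_add_UP
  polynomial_D del: poly_add.simps)

text \<open>The coefficients lie in \<open>K\<close>, the center of \<open>D\<close>. This makes
  \<open>f\<close> central in \<open>U\<close> and lets the images of \<open>D\<close> and
  \<open>L\<close> commute in the quotient.\<close>

lemma coeff_commute: "\<lbrakk>q \<in> carrier (K[X]); p \<in> carrier U\<rbrakk> \<Longrightarrow> coeff q \<otimes>\<^bsub>U\<^esub> p = p \<otimes>\<^bsub>U\<^esub> coeff q"
  by (rule U.commute_if_coeffs_commute) (auto simp: coeff_in_U coeff_UP coeff_in_K K_commute)

lemma coeff_f: "coeff f \<in> carrier U" "coeff f \<noteq> \<zero>\<^bsub>U\<^esub>" "deg D (coeff f) = degree f"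
  subgoal by (rule coeff_in_U[OF f_closed])
  subgoal using deg_coeff[OF polynomial_D[OF f_closed]] degree_f by auto
  subgoal by (rule deg_coeff[OF polynomial_D[OF f_closed]])
  done

lemma lcoeff_unit: "\<lbrakk>p \<in> carrier U; p \<noteq> \<zero>\<^bsub>U\<^esub>\<rbrakk> \<Longrightarrow> up_ring.coeff U p (deg D p) \<in> Units D"
  using U.lcoeff_nonzero[of p] U.lcoeff_closed[of p] by (simp add: units)

text \<open>The coefficient at the sum of the degrees is the product of the leading coefficients,
  which is nonzero in a division ring.\<close>

lemma U_mult_nonzero_deg:
  assumes "p \<in> carrier U" "q \<in> carrier U" "p \<noteq> \<zero>\<^bsub>U\<^esub>" "q \<noteq> \<zero>\<^bsub>U\<^esub>"
  shows "p \<otimes>\<^bsub>U\<^esub> q \<noteq> \<zero>\<^bsub>U\<^esub>" "deg D (p \<otimes>\<^bsub>U\<^esub> q) = deg D p + deg D q"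
proof -
  have "up_ring.coeff U (p \<otimes>\<^bsub>U\<^esub> q) (deg D p + deg D q) \<noteq> \<zero>"
    using assms integral U.lcoeff_nonzero U.lcoeff_closed by (simp add: U.lcoeff_mult del: U.coeff_mult)
  then show "p \<otimes>\<^bsub>U\<^esub> q \<noteq> \<zero>\<^bsub>U\<^esub>" "deg D (p \<otimes>\<^bsub>U\<^esub> q) = deg D p + deg D q"
    using assms U.deg_belowI[of "deg D p + deg D q" "p \<otimes>\<^bsub>U\<^esub> q"] U.deg_mult_ring[of p q]
    by (force simp del: U.coeff_mult)+
qed

lemma irreducible_iff_quotient:
  "irreducible_poly_over D f \<longleftrightarrow> zero_divisor_free (U Quot J)"
proof -
  have "f \<in> carrier (poly_ring D)"
    using polynomial_D[OF f_closed] by (simp add: univ_poly_carrier)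
  from irreducible_poly_over_iff_UP[OF this degree_f] show ?thesis
    using coeff_f degree_f U.UP_ring coeff_commute[OF f_closed] U_mult_nonzero_deg
      U.right_division[OF _ lcoeff_unit]
    by (subst quotient_by_central_zero_divisor_free_iff[where \<delta> = "deg D"]) simp_all
qed

lemma ideal_J: "ideal J U"
  by (rule U.ideal_central_multiples[OF coeff_f(1) coeff_commute[OF f_closed]])

text \<open>A nonzero multiple of \<open>f\<close> has degree at least \<open>degree f\<close>. This
  yields the injectivity of the comparison map on reduced tensors.\<close>

lemma J_deg:
  assumes "p \<in> J" "deg D p < degree f"
  shows "p = \<zero>\<^bsub>U\<^esub>"
proof -
  obtain q where q: "q \<in> carrier U" "p = q \<otimes>\<^bsub>U\<^esub> coeff f" using assms(1) by blast
  show ?thesis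
  proof (cases "q = \<zero>\<^bsub>U\<^esub>")
    case True
    then show ?thesis using q coeff_f(1) by simp
  next
    case False
    then show ?thesis using U_mult_nonzero_deg(2)[OF q(1) coeff_f(1) False coeff_f(2)] q(2) assms(2) coeff_f(3)
      by simp
  qed
qed

section \<open>Normal form of tensors modulo the bilinearity relations\<close>

lemma poly_of_const_closed: "k \<in> K \<Longrightarrow> poly_of_const k \<in> carrier (K[X])"
  unfolding poly_of_const_def univ_poly_carrier[symmetric]
  by (rule normalize_gives_polynomial) simp

lemma psi_closed: "k \<in> K \<Longrightarrow> \<psi> k \<in> carrier L"
  unfolding rupture_const_def by (rule quot.hom_closed[OF poly_of_const_closed])

lemma K_closed: "k \<in> K \<Longrightarrow> k \<in> carrier D"
  using K_sub by blast

lemma X_closed: "X \<in> carrier (K[X])"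
  using E.var_closed(1)[OF E.carrier_is_subring] by (simp add: KX_eq var_def)

lemma alpha_closed: "\<alpha> \<in> carrier L"
  by (rule quot.hom_closed[OF X_closed])

lemma alpha_pow_closed: "\<alpha> [^]\<^bsub>L\<^esub> (i::nat) \<in> carrier L"
  by (rule L.nat_pow_closed[OF alpha_closed])

lemma K_Pi: "(\<lambda>k. k) \<in> K \<rightarrow> carrier D"
  using K_closed by simp

lemma psi_Pi: "\<psi> \<in> K \<rightarrow> carrier L"
  using psi_closed by simp

lemmas tensor_facts = ring_axioms L.ring_axioms K_Pi psi_Pi
lemmas N_zero = tensor_subgroup_zero[where \<phi> = "\<lambda>k. k" and \<psi> = \<psi>, OF tensor_facts]
lemmas N_add = tensor_subgroup_add[where \<phi> = "\<lambda>k. k" and \<psi> = \<psi>, OF tensor_facts]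
lemmas N_diff = tensor_subgroup_diff[where \<phi> = "\<lambda>k. k" and \<psi> = \<psi>, OF tensor_facts]
lemmas N_sum = tensor_subgroup_sum[where \<phi> = "\<lambda>k. k" and \<psi> = \<psi>, OF tensor_facts]
lemmas N_zero_left = tensor_subgroup_zero_left[where \<phi> = "\<lambda>k. k" and \<psi> = \<psi>, OF tensor_facts]
lemmas N_diff_left = tensor_subgroup_diff_left[where \<phi> = "\<lambda>k. k" and \<psi> = \<psi>, OF tensor_facts]
lemmas N_finsum_right = tensor_subgroup_finsum_right[where \<phi> = "\<lambda>k. k" and \<psi> = \<psi>, OF tensor_facts]

text \<open>The normal form of a tensor in powers of the class of \<open>X\<close>. The bound
  \<open>n\<close> is a parameter: it is \<open>degree f\<close> for normal forms, but arbitrarily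
  large when polynomials are lifted to tensors.\<close>

definition reduced where
  "reduced n g = (\<Sum>i<n. frag_of (g i, \<alpha> [^]\<^bsub>L\<^esub> (i::nat)))"

lemma reduced_diff:
  assumes "\<And>i. g i \<in> carrier D" "\<And>i. h i \<in> carrier D"
  shows "reduced n g - reduced n h - reduced n (\<lambda>i. g i \<ominus> h i) \<in> N"
  unfolding reduced_def sum_subtractf[symmetric]
  using assms alpha_pow_closed by (intro N_sum N_diff_left)

lemma reduced_zero: "reduced n (\<lambda>_. \<zero>) \<in> N"
  unfolding reduced_def by (intro N_sum N_zero_left alpha_pow_closed)

lemma reduced_single:
  assumes "i < n" shows "frag_of (a, \<alpha> [^]\<^bsub>L\<^esub> i) - reduced n (\<lambda>j. if j = i then a else \<zero>) \<in> N"
proof -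
  let ?g = "\<lambda>j. if j = i then a else \<zero>"
  have "reduced n ?g = frag_of (a, \<alpha> [^]\<^bsub>L\<^esub> i) + (\<Sum>j \<in> {..<n} - {i}. frag_of (?g j, \<alpha> [^]\<^bsub>L\<^esub> j))"
    unfolding reduced_def using assms by (subst sum.remove[of _ i]) auto
  moreover have "(\<Sum>j \<in> {..<n} - {i}. frag_of (?g j, \<alpha> [^]\<^bsub>L\<^esub> j)) \<in> N"
    by (intro N_sum) (auto intro: N_zero_left alpha_pow_closed)
  ultimately show ?thesis using N_diff[OF N_zero] by simp
qed

text \<open>The set \<open>T\<close> consists of the pairs of coefficient and exponent in the
  expansion of \<open>q\<close> in powers of \<open>X\<close>, to which \<open>quot\<close> is
  applied.\<close>

lemma quot_expansion:
  assumes q: "q \<in> carrier (K[X])"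
  obtains T where "finite T" "fst ` T \<subseteq> K" "snd ` T \<subseteq> {..<length q}"
    "quot q = (\<Oplus>\<^bsub>L\<^esub>t \<in> T. \<psi> (fst t) \<otimes>\<^bsub>L\<^esub> \<alpha> [^]\<^bsub>L\<^esub> snd t)"
proof
  let ?T = "set (E.dense_repr q)"
  have q_E: "q \<in> carrier ((carrier E)[X]\<^bsub>E\<^esub>)" using q by (simp add: KX_eq)
  have fst: "fst t \<in> K - {\<zero>}" if "t \<in> ?T" for t
    using E.dense_repr_set_fst[of q K] that polynomial_incl[of K q] q
    by (auto simp: univ_poly_carrier)
  show "finite ?T" by simp
  show "fst ` ?T \<subseteq> K" using fst by auto
  show "snd ` ?T \<subseteq> {..<length q}" by (rule E.dense_repr_set_snd)
  have "quot q = (\<Oplus>\<^bsub>L\<^esub>t \<in> ?T. quot [fst t] \<otimes>\<^bsub>L\<^esub> \<alpha> [^]\<^bsub>L\<^esub> snd t)"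
    using E.hom_var_pow_finsum[OF E.carrier_is_subring q_E, of L quot] quot.ring_hom_ring_axioms
    by (simp add: KX_eq var_def)
  also have "\<dots> = (\<Oplus>\<^bsub>L\<^esub>t \<in> ?T. \<psi> (fst t) \<otimes>\<^bsub>L\<^esub> \<alpha> [^]\<^bsub>L\<^esub> snd t)"
  proof (rule L.finsum_cong')
    fix t assume t: "t \<in> ?T"
    \<comment> \<open>The dense representation lists nonzero coefficients only; on zero
      \<open>poly_of_const\<close> would give the empty list.\<close>
    have "[fst t] = poly_of_const (fst t)" using fst[OF t] by (simp add: poly_of_const_def)
    then show "quot [fst t] \<otimes>\<^bsub>L\<^esub> \<alpha> [^]\<^bsub>L\<^esub> snd t = \<psi> (fst t) \<otimes>\<^bsub>L\<^esub> \<alpha> [^]\<^bsub>L\<^esub> snd t"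
      by (simp add: rupture_const_def)
  qed (use fst psi_closed alpha_pow_closed in auto)
  finally show "quot q = (\<Oplus>\<^bsub>L\<^esub>t \<in> ?T. \<psi> (fst t) \<otimes>\<^bsub>L\<^esub> \<alpha> [^]\<^bsub>L\<^esub> snd t)" .
qed

text \<open>The remainder on division by \<open>f\<close>. Bounding its length covers the zero
  polynomial too and keeps all exponents below \<open>degree f\<close>.\<close>

lemma L_representative:
  assumes "c \<in> carrier L"
  obtains r where "r \<in> carrier (K[X])" "c = quot r" "length r \<le> degree f"
proof -
  obtain q where q: "q \<in> carrier (K[X])" "c = quot q"
    using assms unfolding rupture_def FactRing_def A_RCOSETS_def' by auto
  obtain b r where br: "b \<in> carrier (K[X])" "r \<in> carrier (K[X])"
      "q = f \<otimes>\<^bsub>K[X]\<^esub> b \<oplus>\<^bsub>K[X]\<^esub> r" "r = [] \<or> degree r < degree f"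
    using subfield_long_division_theorem_shell[OF subfield_K q(1) f_closed] f_nonzero
    by (auto simp: univ_poly_zero)
  have "quot f = \<zero>\<^bsub>L\<^esub>"
    unfolding rupture_def
    using PIdl.a_rcos_const[OF KX.cgenideal_self[OF f_closed]] by (simp add: FactRing_def)
  then have "quot q = quot r"
    unfolding br(3) using br(1,2) f_closed by simp
  moreover have "length r \<le> degree f" using br(4) degree_f by auto
  ultimately show thesis using that br(2) q(2) by metis
qed

text \<open>The sums with a normal form contain \<open>N\<close> and are closed under differences,
  so a single generator suffices. There the right factor is expanded in powers of
  \<open>\<alpha>\<close> and the scalars move into \<open>D\<close>.\<close>

lemma pair_ring_reduced:
  assumes "u \<in> carrier (pair_ring D L)"
  obtains g where "\<forall>i. g i \<in> carrier D" "u - reduced (degree f) g \<in> N"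
proof -
  define W where "W u \<longleftrightarrow> (\<exists>g. (\<forall>i. g i \<in> carrier D) \<and> u - reduced (degree f) g \<in> N)" for u
  have W_N: "W u" if "u \<in> N" for u
    unfolding W_def using N_diff[OF that reduced_zero] by (intro exI[of _ "\<lambda>_. \<zero>"]) simp
  have W_diff: "W (u - v)" if "W u" "W v" for u v
  proof -
    from that(1) obtain g where "\<forall>i. g i \<in> carrier D" and g2: "u - reduced (degree f) g \<in> N"
      unfolding W_def by (elim exE conjE)
    then have g1: "g i \<in> carrier D" for i by simp
    from that(2) obtain h where "\<forall>i. h i \<in> carrier D" and h2: "v - reduced (degree f) h \<in> N"
      unfolding W_def by (elim exE conjE)
    then have h1: "h i \<in> carrier D" for i by simp
    have "u - v - reduced (degree f) (\<lambda>i. g i \<ominus> h i) \<in> N"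
      using N_add[OF N_diff[OF g2 h2] reduced_diff[of g h "degree f", OF g1 h1]]
      by (simp add: algebra_simps)
    then show ?thesis
      unfolding W_def using g1 h1 by (intro exI[of _ "\<lambda>i. g i \<ominus> h i"]) simp
  qed
  have W_add: "W (u + v)" if "W u" "W v" for u v
    using W_diff[OF that(1) W_diff[OF W_N[OF N_zero] that(2)]] by simp
  have W_sum: "W (sum w T)" if "finite T" "\<And>t. t \<in> T \<Longrightarrow> W (w t)" for w and T :: "('a \<times> nat) set"
    using that by (induction T) (auto intro: W_N[OF N_zero] W_add)
  have W_single: "W (frag_of (a, \<alpha> [^]\<^bsub>L\<^esub> i))" if "a \<in> carrier D" "i < degree f" for a i
    unfolding W_def using reduced_single[OF that(2), of a] that(1)
    by (intro exI[of _ "\<lambda>j. if j = i then a else \<zero>"]) simp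
  have gen: "W (frag_of (a, c))" if a: "a \<in> carrier D" and c: "c \<in> carrier L" for a c
  proof -
    obtain r where r: "r \<in> carrier (K[X])" "c = quot r" "length r \<le> degree f"
      by (rule L_representative[OF c])
    obtain T where T: "finite T" "fst ` T \<subseteq> K" "snd ` T \<subseteq> {..<length r}"
      "quot r = (\<Oplus>\<^bsub>L\<^esub>t \<in> T. \<psi> (fst t) \<otimes>\<^bsub>L\<^esub> \<alpha> [^]\<^bsub>L\<^esub> snd t)"
      by (rule quot_expansion[OF r(1)])
    let ?s = "\<Sum>t \<in> T. frag_of (fst t \<otimes> a, \<alpha> [^]\<^bsub>L\<^esub> snd t)"
    have "frag_of (a, c) - ?s \<in> N"
      unfolding r(2) T(4) by (intro N_finsum_right) (use T(1,2) a alpha_pow_closed in auto)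
    moreover have "W ?s"
      using T r(3) a K_closed by (intro W_sum W_single) (auto intro: less_le_trans)
    ultimately show ?thesis using W_add[OF W_N] by fastforce
  qed
  from assms have "W u"
    unfolding carrier_pair_ring mem_Collect_eq
  proof (induction u rule: frag_induction)
    case (one x)
    then show ?case using gen by (cases x) simp
  qed (fact W_N[OF N_zero] W_diff)+
  then obtain g where "\<forall>i. g i \<in> carrier D" "u - reduced (degree f) g \<in> N"
    unfolding W_def by (elim exE conjE)
  then show thesis by (rule that)
qed

section \<open>The isomorphism between the tensor algebra and \<open>U Quot J\<close>\<close>

lemma coeff_const:
  assumes "a \<in> carrier D" shows "coeff (poly_of_const a) = up_ring.monom U a 0"
proof -
  have "coeff (poly_of_const a) = coeff [a]"
    unfolding poly_of_const_def by (rule normalize_coeff[symmetric])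
  also have "\<dots> = up_ring.monom U a 0"
    by (rule ext) (use assms in \<open>simp add: UP_def\<close>)
  finally show ?thesis .
qed

lemma coeff_var: "coeff X = up_ring.monom U \<one> 1"
  by (rule ext) (simp add: var_def UP_def)

text \<open>The map \<open>\<theta>\<close> on formal sums is onto \<open>U Quot J\<close> with
  kernel exactly \<open>N\<close>, so it induces an isomorphism from the tensor algebra.\<close>

lemma tensor_zero_divisor_free_iff:
  "zero_divisor_free (tensor_algebra K D (\<lambda>k. k) L \<psi>) \<longleftrightarrow> zero_divisor_free (U Quot J)"
proof -
  interpret J: ideal J U by (rule ideal_J)
  let ?Q = "U Quot J"
  interpret Q: ring ?Q by (rule J.quotient_is_ring)
  interpret F: ring "pair_ring D L" by (rule ring_pair_ring) unfold_locales
  have cls_zero: "J +>\<^bsub>U\<^esub> p = \<zero>\<^bsub>?Q\<^esub> \<longleftrightarrow> p \<in> J" if "p \<in> carrier U" for p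
    using that by (metis (no_types, lifting) FactRing_def J.a_rcos_const J.a_rcos_self ring.simps(1))
  have cls_mult: "(J +>\<^bsub>U\<^esub> p) \<otimes>\<^bsub>?Q\<^esub> (J +>\<^bsub>U\<^esub> q) = J +>\<^bsub>U\<^esub> (p \<otimes>\<^bsub>U\<^esub> q)"
    and cls_add: "(J +>\<^bsub>U\<^esub> p) \<oplus>\<^bsub>?Q\<^esub> (J +>\<^bsub>U\<^esub> q) = J +>\<^bsub>U\<^esub> (p \<oplus>\<^bsub>U\<^esub> q)"
    if "p \<in> carrier U" "q \<in> carrier U" for p q
    using that by (simp_all add: FactRing_def J.rcoset_mult_add J.a_rcos_sum)
  define h where "h = (+>\<^bsub>U\<^esub>) J \<circ> (\<lambda>a. up_ring.monom U a 0)"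
  have h_hom: "h \<in> ring_hom D ?Q"
    unfolding h_def by (rule ring_hom_trans[OF U.const_ring_hom J.rcos_ring_hom])
  have k_hom: "(+>\<^bsub>U\<^esub>) J \<circ> coeff \<in> ring_hom (K[X]) ?Q"
    by (rule ring_hom_trans[OF coeff_hom J.rcos_ring_hom])
  have k_zero: "((+>\<^bsub>U\<^esub>) J \<circ> coeff) x = \<zero>\<^bsub>?Q\<^esub>" if "x \<in> PIdl\<^bsub>K[X]\<^esub> f" for x
  proof -
    from that obtain y where y: "y \<in> carrier (K[X])" "x = y \<otimes>\<^bsub>K[X]\<^esub> f"
      unfolding cgenideal_def by blast
    have "coeff x = coeff y \<otimes>\<^bsub>U\<^esub> coeff f"
      unfolding y(2) by (rule ring_hom_mult[OF coeff_hom y(1) f_closed])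
    then have "coeff x \<in> J" using coeff_in_U[OF y(1)] by blast
    then show ?thesis unfolding comp_apply using cls_zero[OF J.Icarr] by blast
  qed
  \<comment> \<open>The map from \<open>K[X]\<close> sends every multiple of \<open>f\<close> into
    \<open>J\<close>, hence factors through \<open>L\<close>.\<close>
  obtain g where g_hom: "g \<in> ring_hom L ?Q"
    and "\<forall>q \<in> carrier (K[X]). g (quot q) = ((+>\<^bsub>U\<^esub>) J \<circ> coeff) q"
    by (rule induced_hom_exists[OF PIdl.ideal_axioms Q.ring_axioms k_hom k_zero, folded rupture_def])
  then have g: "g (quot q) = J +>\<^bsub>U\<^esub> coeff q" if "q \<in> carrier (K[X])" for q
    using that by simp
  have comm: "h a \<otimes>\<^bsub>?Q\<^esub> g c = g c \<otimes>\<^bsub>?Q\<^esub> h a" if a: "a \<in> carrier D" and c: "c \<in> carrier L" for a c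
  proof -
    obtain q where q: "q \<in> carrier (K[X])" "c = quot q" by (rule L_representative[OF c])
    then show ?thesis
      using a coeff_commute[OF q(1), of "up_ring.monom U a 0"] by (simp add: h_def g cls_mult coeff_in_U)
  qed
  obtain \<theta> where \<theta>_hom: "\<theta> \<in> ring_hom (pair_ring D L) ?Q"
    and \<theta>: "\<forall>a \<in> carrier D. \<forall>c \<in> carrier L. \<theta> (frag_of (a, c)) = h a \<otimes>\<^bsub>?Q\<^esub> g c"
    by (rule pair_ring_hom_exists[OF ring_axioms L.ring_axioms Q.ring_axioms h_hom g_hom comm])
  interpret \<theta>: ring_hom_ring "pair_ring D L" ?Q \<theta>
    by (rule ring_hom_ringI2[OF F.ring_axioms Q.ring_axioms \<theta>_hom])
  have scalars: "h k = g (\<psi> k)" if "k \<in> K" for k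
    using that K_closed[OF that] by (simp add: rupture_const_def g poly_of_const_closed coeff_const h_def)
  have N_kernel: "N \<subseteq> a_kernel (pair_ring D L) ?Q \<theta>"
    by (rule tensor_subgroup_subset_kernel[OF tensor_facts Q.ring_axioms \<theta>_hom h_hom g_hom])
      (use \<theta> comm scalars in auto)
  interpret g: ring_hom_ring L ?Q g
    by (rule ring_hom_ringI2[OF L.ring_axioms Q.ring_axioms g_hom])
  interpret cls: ring_hom_ring U ?Q "(+>\<^bsub>U\<^esub>) J"
    by (rule J.rcos_ring_hom_ring)
  have g_pow: "g (\<alpha> [^]\<^bsub>L\<^esub> i) = J +>\<^bsub>U\<^esub> up_ring.monom U \<one> i" for i :: nat
  proof -
    have "g (\<alpha> [^]\<^bsub>L\<^esub> i) = (J +>\<^bsub>U\<^esub> up_ring.monom U \<one> 1) [^]\<^bsub>?Q\<^esub> i"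
      by (simp only: g.hom_nat_pow[OF alpha_closed] g[OF X_closed] coeff_var)
    also have "\<dots> = J +>\<^bsub>U\<^esub> (up_ring.monom U \<one> 1 [^]\<^bsub>U\<^esub> i)"
      by (rule cls.hom_nat_pow[symmetric]) simp
    finally show ?thesis unfolding U.monom_one_pow .
  qed
  \<comment> \<open>The class of \<open>X\<close> goes to the class of the variable of
    \<open>U\<close>, so the generator becomes a constant times a power of the variable.\<close>
  have \<theta>_monom: "\<theta> (frag_of (a, \<alpha> [^]\<^bsub>L\<^esub> i)) = J +>\<^bsub>U\<^esub> up_ring.monom U a i"
    if "a \<in> carrier D" for a and i :: nat
  proof -
    have "\<theta> (frag_of (a, \<alpha> [^]\<^bsub>L\<^esub> i)) = h a \<otimes>\<^bsub>?Q\<^esub> g (\<alpha> [^]\<^bsub>L\<^esub> i)"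
      using \<theta> that alpha_pow_closed by blast
    also have "\<dots> = J +>\<^bsub>U\<^esub> (up_ring.monom U a 0 \<otimes>\<^bsub>U\<^esub> up_ring.monom U \<one> i)"
      unfolding h_def comp_apply g_pow using that by (intro cls_mult) simp_all
    also have "up_ring.monom U a 0 \<otimes>\<^bsub>U\<^esub> up_ring.monom U \<one> i = up_ring.monom U a i"
      using U.monom_mult[OF that monoid.one_closed[OF monoid_axioms], of 0 i] that by (simp del: U.monom_mult)
    finally show ?thesis .
  qed
  have reduced_closed: "reduced n u \<in> carrier (pair_ring D L)" if "\<And>i. u i \<in> carrier D" for n u
    unfolding reduced_def carrier_pair_ring using that alpha_pow_closed
    by (auto dest!: subsetD[OF keys_sum])
  have \<theta>_reduced: "\<theta> (reduced n u) = J +>\<^bsub>U\<^esub> (\<Oplus>\<^bsub>U\<^esub>i \<in> {..<n}. up_ring.monom U (u i) i)"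
    if u: "\<And>i. u i \<in> carrier D" for n u
  proof (induction n)
    case 0
    then show ?case using \<theta>.hom_zero cls_zero[of "\<zero>\<^bsub>U\<^esub>"]
      by (simp add: reduced_def zero_pair_ring)
  next
    case (Suc n)
    have "reduced (Suc n) u = reduced n u \<oplus>\<^bsub>pair_ring D L\<^esub> frag_of (u n, \<alpha> [^]\<^bsub>L\<^esub> n)"
      by (simp add: reduced_def add_pair_ring)
    then have "\<theta> (reduced (Suc n) u) = \<theta> (reduced n u) \<oplus>\<^bsub>?Q\<^esub> \<theta> (frag_of (u n, \<alpha> [^]\<^bsub>L\<^esub> n))"
      using reduced_closed u alpha_pow_closed by simp
    also have "\<dots> = J +>\<^bsub>U\<^esub> (up_ring.monom U (u n) n \<oplus>\<^bsub>U\<^esub> (\<Oplus>\<^bsub>U\<^esub>i \<in> {..<n}. up_ring.monom U (u i) i))"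
      unfolding Suc \<theta>_monom[OF u]
      using u by (subst cls_add) (auto simp: U.P.a_comm intro!: U.P.finsum_closed)
    also have "up_ring.monom U (u n) n \<oplus>\<^bsub>U\<^esub> (\<Oplus>\<^bsub>U\<^esub>i \<in> {..<n}. up_ring.monom U (u i) i)
        = (\<Oplus>\<^bsub>U\<^esub>i \<in> {..<Suc n}. up_ring.monom U (u i) i)"
      using u by (simp add: lessThan_Suc Pi_def)
    finally show ?case .
  qed
  have "a_kernel (pair_ring D L) ?Q \<theta> \<subseteq> N"
  proof
    fix u assume "u \<in> a_kernel (pair_ring D L) ?Q \<theta>"
    then have u: "u \<in> carrier (pair_ring D L)" "\<theta> u = \<zero>\<^bsub>?Q\<^esub>"
      unfolding a_kernel_def' by blast+
    obtain v where "\<forall>i. v i \<in> carrier D" and v_N: "u - reduced (degree f) v \<in> N"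
      by (rule pair_ring_reduced[OF u(1)])
    then have v_closed: "v i \<in> carrier D" for i by simp
    let ?p = "\<Oplus>\<^bsub>U\<^esub>i \<in> {..<degree f}. up_ring.monom U (v i) i"
    have p: "?p \<in> carrier U" using v_closed by (intro U.P.finsum_closed) auto
    have "\<theta> (u - reduced (degree f) v) = \<zero>\<^bsub>?Q\<^esub>"
      using subsetD[OF N_kernel v_N] unfolding a_kernel_def' by blast
    then have "\<theta> (reduced (degree f) v) = \<zero>\<^bsub>?Q\<^esub>"
      using pair_ring_hom_diff[OF \<theta>.abelian_group_hom_axioms u(1) reduced_closed[of v, OF v_closed]] u(2)
        \<theta>.hom_closed[OF reduced_closed[of v, OF v_closed]]
      by (simp add: Q.minus_eq)
    then have "?p \<in> J"
      unfolding \<theta>_reduced[of v, OF v_closed] cls_zero[OF p] .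
    then have "?p = \<zero>\<^bsub>U\<^esub>"
      using U.deg_finsum_monom_less[where g = v, OF v_closed degree_f] by (rule J_deg)
    then have "v i = \<zero>" if "i < degree f" for i
      using U.coeff_finsum_monom[where g = v, OF v_closed that] by simp
    then have "reduced (degree f) v = reduced (degree f) (\<lambda>_. \<zero>)"
      by (simp add: reduced_def)
    \<comment> \<open>The tensor \<open>reduced (degree f) (\<lambda>_. \<zero>)\<close> need not be
      0 as a formal sum, but it belongs to \<open>N\<close>; adding it back gives
      \<open>u\<close>.\<close>
    then show "u \<in> N" using N_add[OF v_N reduced_zero[of "degree f"]] by simp
  qed
  then have kernel: "a_kernel (pair_ring D L) ?Q \<theta> = N" using N_kernel by blast
  have "\<theta> ` carrier (pair_ring D L) = carrier ?Q"
  proof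
    show "carrier ?Q \<subseteq> \<theta> ` carrier (pair_ring D L)"
    proof
      fix c assume "c \<in> carrier ?Q"
      then obtain p where p: "p \<in> carrier U" "c = J +>\<^bsub>U\<^esub> p"
        unfolding FactRing_def A_RCOSETS_def' by auto
      note coeff_p = U.coeff_closed[OF p(1)]
      \<comment> \<open>The coefficients of \<open>p\<close> themselves give a preimage;
        \<open>Suc\<close> turns the strict range of \<open>reduced\<close> into the closed one of
        \<open>U.up_repr\<close>.\<close>
      have "c = \<theta> (reduced (Suc (deg D p)) (up_ring.coeff U p))"
        unfolding \<theta>_reduced[of "up_ring.coeff U p", OF coeff_p] lessThan_Suc_atMost U.up_repr[OF p(1)]
        by (rule p(2))
      then show "c \<in> \<theta> ` carrier (pair_ring D L)"
        by (rule image_eqI) (rule reduced_closed[OF coeff_p])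
    qed
  qed (rule image_subsetI, rule \<theta>.hom_closed)
  from zero_divisor_free_iso[OF ideal.quotient_is_ring[OF \<theta>.kernel_is_ideal] Q.ring_axioms
      \<theta>.FactRing_iso_set[OF this]]
  show ?thesis unfolding kernel tensor_algebra_def .
qed

end

theorem theorem2:
  fixes D :: "('a, 'm) ring_scheme" and K :: "'a set" and f :: "'a list"
  assumes "central_division_algebra K D"
    and "f \<in> carrier (K[X]\<^bsub>D\<^esub>)"
    and "pirreducible\<^bsub>D\<^esub> K f"
  shows "irreducible_poly_over D f \<longleftrightarrow>
    zero_divisor_free (tensor_algebra K D (\<lambda>k. k) (Rupt\<^bsub>D\<^esub> K f) (rupture_const D K f))"
proof -
  interpret central_irreducible_polynomial K D f
    using assms by (simp add: central_irreducible_polynomial_def central_irreducible_polynomial_axioms_def)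
  \<comment> \<open>Both sides are equivalent to
    \<open>zero_divisor_free (U Quot J)\<close>.\<close>
  show ?thesis
    unfolding irreducible_iff_quotient tensor_zero_divisor_free_iff ..
qed

end
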